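(* Let $m,n$ be positive integers and let $X\in\mathbb{R}^{m\times n}$ be a generic matrix of rank $r<\min\{m,n\}$. Let $\pi$ be a permutation of the $mn$ entries of $m\times n$ matrices and let $Y=\pi(X)$. For $\nu\in\{1,\dots,mn\}$ let $p_\nu(Z)=\sum_{i=1}^m\sum_{j=1}^n z_{ij}^\nu$, where $Z=(z_{ij})$ is an $m\times n$ matrix of variables. Consider the polynomial system defined by $r(m+n-r)+1$ generic linear combinations of the equations $p_\nu(Z)=p_\nu(Y)$, $\nu=1,\dots,mn$, that is, the system $$\sum_{\nu=1}^{mn}c_{k,\nu}\,\bigl(p_\nu(Z)-p_\nu(Y)\bigr)=0,\qquad k=1,\dots,r(m+n-r)+1,$$ with generic coefficients $c_{k,\nu}\in\mathbb{R}$. Then the only rank-$r$ solutions of this system are the following permutations of $X$: the matrices $\Pi_1X\Pi_2$ with $\Pi_1$ (of size $m\times m$) and $\Pi_2$ (of size $n\times n$) permutation matrices, and, in case $m=n$, the matrix $X^\top$.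
   Context: For a permutation $\pi$ of the coordinates of $\mathbb{R}^{m\times n}$, $\pi(X)$ is the matrix obtained from $X$ by permuting its entries according to $\pi$; note $p_\nu(\pi(X))=p_\nu(X)$. "A generic matrix of rank $r$" means: the statement holds for every rank-$r$ matrix $X$ in some non-empty Zariski-open subset of the irreducible variety $\{W\in\mathbb{R}^{m\times n}:\operatorname{rank}(W)\le r\}$. "Generic linear combinations" means that the coefficient vectors $(c_{k,1},\dots,c_{k,mn})\in\mathbb{R}^{mn}$ are chosen, successively for $k=1,2,\dots$, in suitable non-empty Zariski-open subsets of $\mathbb{R}^{mn}$ (which may depend on $X$ and on the previously chosen coefficients).
   Formalization: For m = n the listed solutions include all Π₁XᵀΠ₂ with permutation matrices Π₁, Π₂, not only Xᵀ: these are also rank-r permutations of X and so solve the system, so the list with Xᵀ alone is incomplete. *)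

theory Defs
  imports "Jordan_Normal_Form.DL_Rank" "HOL-Combinatorics.Permutations"
begin

(* The real algebra of functions generated by a set C of coordinate functions, i.e. the
   polynomial functions in these coordinates. *)
inductive_set poly_funs :: "('a \<Rightarrow> real) set \<Rightarrow> ('a \<Rightarrow> real) set"
  for C :: "('a \<Rightarrow> real) set" where
  const: "(\<lambda>_. a) \<in> poly_funs C"
| coord: "f \<in> C \<Longrightarrow> f \<in> poly_funs C"
| add: "f \<in> poly_funs C \<Longrightarrow> g \<in> poly_funs C \<Longrightarrow> (\<lambda>x. f x + g x) \<in> poly_funs C"
| mult: "f \<in> poly_funs C \<Longrightarrow> g \<in> poly_funs C \<Longrightarrow> (\<lambda>x. f x * g x) \<in> poly_funs C"

definition mat_coords :: "nat \<Rightarrow> nat \<Rightarrow> (real mat \<Rightarrow> real) set" where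
  "mat_coords m n = {(\<lambda>Z. Z $$ (i, j)) | i j. i < m \<and> j < n}"

definition vec_coords :: "nat \<Rightarrow> (real vec \<Rightarrow> real) set" where
  "vec_coords d = {(\<lambda>v. v $ i) | i. i < d}"

(* U is open in the subspace topology that S inherits from the Zariski topology of the
   ambient affine space with coordinates C. *)
definition zariski_open_in :: "('a \<Rightarrow> real) set \<Rightarrow> 'a set \<Rightarrow> 'a set \<Rightarrow> bool" where
  "zariski_open_in C S U \<longleftrightarrow> (\<exists>F \<subseteq> poly_funs C. U = {x \<in> S. \<exists>f \<in> F. f x \<noteq> 0})"

definition generic_in :: "('a \<Rightarrow> real) set \<Rightarrow> 'a set \<Rightarrow> ('a \<Rightarrow> bool) \<Rightarrow> bool" where
  "generic_in C S P \<longleftrightarrow> (\<exists>U. zariski_open_in C S U \<and> U \<noteq> {} \<and> (\<forall>x \<in> U. P x))"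

(* P holds for every list of N points of S chosen one after the other, each from a non-empty
   Zariski-open subset of S that may depend on the points chosen before. *)
primrec generic_seq_in ::
  "('a \<Rightarrow> real) set \<Rightarrow> 'a set \<Rightarrow> nat \<Rightarrow> ('a list \<Rightarrow> bool) \<Rightarrow> bool" where
  "generic_seq_in C S 0 P \<longleftrightarrow> P []"
| "generic_seq_in C S (Suc N) P \<longleftrightarrow>
     generic_in C S (\<lambda>x. generic_seq_in C S N (\<lambda>xs. P (x # xs)))"

definition rank_le_variety :: "nat \<Rightarrow> nat \<Rightarrow> nat \<Rightarrow> real mat set" where
  "rank_le_variety m n r = {W \<in> carrier_mat m n. vec_space.rank m W \<le> r}"

definition entry_perm :: "(nat \<times> nat \<Rightarrow> nat \<times> nat) \<Rightarrow> real mat \<Rightarrow> real mat" where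
  "entry_perm \<pi> X = mat (dim_row X) (dim_col X) (\<lambda>ij. X $$ \<pi> ij)"

definition power_sum :: "nat \<Rightarrow> real mat \<Rightarrow> real" where
  "power_sum \<nu> Z = (\<Sum>i<dim_row Z. \<Sum>j<dim_col Z. (Z $$ (i, j)) ^ \<nu>)"

definition perm_mats :: "nat \<Rightarrow> real mat set" where
  "perm_mats k =
     {mat k k (\<lambda>(i, j). if i = \<sigma> j then 1 else 0) | \<sigma>. \<sigma> permutes {..<k}}"

(* Vectors are indexed from 0, so the coefficient of the \<nu>-th equation is entry \<nu> - 1. *)
definition lin_comb_eq :: "nat \<Rightarrow> real vec \<Rightarrow> real mat \<Rightarrow> real mat \<Rightarrow> bool" where
  "lin_comb_eq d c Y Z \<longleftrightarrow> (\<Sum>\<nu>=1..d. c $ (\<nu> - 1) * (power_sum \<nu> Z - power_sum \<nu> Y)) = 0"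

(* For m = n the transposition is combined with row and column permutations: the matrices
   \<Pi>1 * X\<^sup>T * \<Pi>2 all have the rank and the entries of X. *)
definition trivial_perms :: "nat \<Rightarrow> nat \<Rightarrow> real mat \<Rightarrow> real mat set" where
  "trivial_perms m n X =
     {P * X * Q | P Q. P \<in> perm_mats m \<and> Q \<in> perm_mats n} \<union>
     (if m = n then {P * X\<^sup>T * Q | P Q. P \<in> perm_mats m \<and> Q \<in> perm_mats n} else {})"

end

theory Submission
  imports Defs "HOL-Computational_Algebra.Polynomial_FPS"
begin

text \<open>Two steps. First, if \<open>\<pi>(X)\<close> has rank at most \<open>r\<close> for generic \<open>X\<close>, then \<open>\<pi>\<close> preserves the sets
  of \<open>r + 1\<close> cells in distinct rows and columns (test on 0/1 matrices), hence collinearity of cells,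
  so it is a product of a row and a column permutation, possibly after transposition. Thus only
  trivial permutations of a generic \<open>X\<close> have rank \<open>r\<close>. Second, generic linear combinations force all
  the equations \<open>p\<^sub>\<nu>(Z) = p\<^sub>\<nu>(Y)\<close>, and hence that \<open>Z\<close> permutes \<open>X\<close>: the coefficient tuples admitting
  another solution of rank \<open>r\<close> are the image of finitely many rational maps with one parameter less
  than there are coefficients, and counting monomials gives a non-zero polynomial that vanishes on
  such an image; no dimension theory is needed.\<close>

section \<open>Polynomial functions and irreducibility\<close>

text \<open>The number \<open>r * (m + n - r) + 1\<close> is one more than the dimension of the set
  of rank-r matrices. Put d = m * n and let N be the number of equations. A solution Z whose vector
  of differences of power sums is non-zero forces each of the N coefficient vectors into a
  hyperplane, so such Z together with their coefficients have r * (m + n - r) + N * (d - 1)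
  parameters; this is less than N * d exactly when N exceeds r * (m + n - r). Solutions with zero
  difference vector survive every choice of coefficients. By Newton's identities they have the
  entries of X as a multiset, so they are among finitely many matrices, one for each permutation of
  the cells, and only the rank can select between them. Finiteness also makes the condition on X
  uniform in \<pi>: the conditions for the single permutations are multiplied, and irreducibility of
  the variety keeps the product from vanishing on it.\<close>

lemma poly_funs_sum:
  assumes "\<And>a. a \<in> A \<Longrightarrow> f a \<in> poly_funs C"
  shows "(\<lambda>x. \<Sum>a\<in>A. f a x) \<in> poly_funs C"
  using assms
  by (induction A rule: infinite_finite_induct) (auto intro: poly_funs.intros)

lemma poly_funs_prod:
  assumes "\<And>a. a \<in> A \<Longrightarrow> f a \<in> poly_funs C"
  shows "(\<lambda>x. \<Prod>a\<in>A. f a x) \<in> poly_funs C"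
  using assms
  by (induction A rule: infinite_finite_induct) (auto intro: poly_funs.intros)

lemma poly_funs_power:
  assumes "f \<in> poly_funs C"
  shows "(\<lambda>x. f x ^ k) \<in> poly_funs C"
  using assms by (induction k) (auto intro: poly_funs.intros)

lemma poly_funs_diff:
  assumes "f \<in> poly_funs C" "g \<in> poly_funs C"
  shows "(\<lambda>x. f x - g x) \<in> poly_funs C"
  using poly_funs.add[OF assms(1) poly_funs.mult[OF poly_funs.const[of "-1"] assms(2)]] by simp

lemma poly_funs_comp:
  assumes "f \<in> poly_funs C" "\<And>g. g \<in> C \<Longrightarrow> (\<lambda>x. g (\<phi> x)) \<in> poly_funs D"
  shows "(\<lambda>x. f (\<phi> x)) \<in> poly_funs D"
  using assms by (induction f rule: poly_funs.induct) (auto intro: poly_funs.intros)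

lemma poly_funs_curve:
  assumes "f \<in> poly_funs C" "\<And>g. g \<in> C \<Longrightarrow> \<exists>p. \<forall>t. g (\<gamma> t) = poly p t"
  shows "\<exists>p. \<forall>t. f (\<gamma> t) = poly p t"
  using assms
proof (induction f rule: poly_funs.induct)
  case (const a)
  show ?case by (rule exI[of _ "[:a:]"]) simp
next
  case (add f g)
  then obtain p q where "\<forall>t. f (\<gamma> t) = poly p t" "\<forall>t. g (\<gamma> t) = poly q t" by blast
  then show ?case by (intro exI[of _ "p + q"]) simp
next
  case (mult f g)
  then obtain p q where "\<forall>t. f (\<gamma> t) = poly p t" "\<forall>t. g (\<gamma> t) = poly q t" by blast
  then show ?case by (intro exI[of _ "p * q"]) simp
qed auto

text \<open>A set any two points of which lie on a polynomial curve inside it is irreducible.\<close>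

definition curve_connected :: "('a \<Rightarrow> real) set \<Rightarrow> 'a set \<Rightarrow> bool" where
  "curve_connected C S \<longleftrightarrow> (\<forall>x\<in>S. \<forall>y\<in>S. \<exists>\<gamma>. \<gamma> (0::real) = x \<and> \<gamma> 1 = y \<and> range \<gamma> \<subseteq> S \<and>
     (\<forall>g\<in>C. \<exists>p. \<forall>t. g (\<gamma> t) = poly p t))"

text \<open>Along a curve from a non-zero of one factor to a non-zero of the product of the others,
  both become non-zero polynomials in one variable, and their product has a non-root. This is
  irreducibility, for finitely many factors at once.\<close>

lemma curve_connected_prod_nonzero:
  assumes S: "curve_connected C S" "S \<noteq> {}" and "finite A"
    and "\<And>a. a \<in> A \<Longrightarrow> f a \<in> poly_funs C" "\<And>a. a \<in> A \<Longrightarrow> \<exists>x\<in>S. f a x \<noteq> 0"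
  shows "\<exists>x\<in>S. (\<Prod>a\<in>A. f a x) \<noteq> 0"
  using assms(3-)
proof (induction A rule: finite_induct)
  case empty
  then show ?case using S by auto
next
  case (insert a A)
  obtain x where x: "x \<in> S" "f a x \<noteq> 0" using insert.prems by blast
  obtain y where y: "y \<in> S" "(\<Prod>a\<in>A. f a y) \<noteq> 0" using insert by blast
  obtain \<gamma> where \<gamma>: "\<gamma> (0::real) = x" "\<gamma> 1 = y" "range \<gamma> \<subseteq> S" "\<forall>g\<in>C. \<exists>p. \<forall>t. g (\<gamma> t) = poly p t"
    using S x y unfolding curve_connected_def by blast
  have "(\<lambda>x. \<Prod>a\<in>A. f a x) \<in> poly_funs C" using insert by (intro poly_funs_prod) auto
  then obtain q where q: "\<forall>t. (\<Prod>a\<in>A. f a (\<gamma> t)) = poly q t"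
    using poly_funs_curve[of "\<lambda>x. \<Prod>a\<in>A. f a x" C \<gamma>] \<gamma> by blast
  obtain p where p: "\<forall>t. f a (\<gamma> t) = poly p t"
    using poly_funs_curve[of "f a" C \<gamma>] \<gamma> insert.prems by blast
  have "p \<noteq> 0" "q \<noteq> 0" using p q x y \<gamma> by (metis poly_0)+
  then have "p * q \<noteq> 0" by simp
  then obtain t where "poly (p * q) t \<noteq> 0" using poly_all_0_iff_0 by blast
  then show ?case using insert p q \<gamma> by (intro bexI[of _ "\<gamma> t"]) auto
qed

definition fun_coords :: "'i set \<Rightarrow> (('i \<Rightarrow> real) \<Rightarrow> real) set" where
  "fun_coords I = {(\<lambda>x. x i) | i. i \<in> I}"

lemma fun_coords_poly_funs: "i \<in> I \<Longrightarrow> (\<lambda>x. x i) \<in> poly_funs (fun_coords I)"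
  by (rule poly_funs.coord) (auto simp: fun_coords_def)

text \<open>Points are total functions, so coordinates outside \<open>I\<close> carry arbitrary
  values; this allows them to be replaced.\<close>

lemma poly_funs_fun_coords_cong:
  assumes "f \<in> poly_funs (fun_coords I)" "\<And>i. i \<in> I \<Longrightarrow> x i = y i"
  shows "f x = f y"
  using assms by (induction f rule: poly_funs.induct) (auto simp: fun_coords_def)

lemma curve_connected_UNIV: "curve_connected (fun_coords I) UNIV"
  unfolding curve_connected_def
proof safe
  fix x y :: "'a \<Rightarrow> real"
  show "\<exists>\<gamma>. \<gamma> (0::real) = x \<and> \<gamma> 1 = y \<and> range \<gamma> \<subseteq> UNIV \<and>
     (\<forall>g\<in>fun_coords I. \<exists>p. \<forall>t. g (\<gamma> t) = poly p t)"
  proof (intro exI[of _ "\<lambda>t i. x i + t * (y i - x i)"] conjI ballI)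
    fix g :: "('a \<Rightarrow> real) \<Rightarrow> real" assume "g \<in> fun_coords I"
    then obtain i where "g = (\<lambda>x. x i)" by (auto simp: fun_coords_def)
    then show "\<exists>p. \<forall>t. g (\<lambda>i. x i + t * (y i - x i)) = poly p t"
      by (intro exI[of _ "[:x i, y i - x i:]"]) simp
  qed auto
qed

section \<open>Images of rational maps\<close>

text \<open>The degree in each variable separately, since that is what a grid detects. Restrictions
  to coordinate lines express it for plain functions, without a type of multivariate
  polynomials.\<close>

definition sep_degree_le :: "nat \<Rightarrow> (('i \<Rightarrow> real) \<Rightarrow> real) \<Rightarrow> bool" where
  "sep_degree_le e f \<longleftrightarrow> (\<forall>x i. \<exists>p. degree p \<le> e \<and> (\<forall>t. f (x(i := t)) = poly p t))"

lemma sep_degree_le_mono: "sep_degree_le e f \<Longrightarrow> e \<le> e' \<Longrightarrow> sep_degree_le e' f"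
  unfolding sep_degree_le_def by (meson order_trans)

lemma sep_degree_le_const: "sep_degree_le e (\<lambda>_. a)"
  unfolding sep_degree_le_def by (intro allI exI[of _ "[:a:]"]) simp

lemma sep_degree_le_add:
  assumes "sep_degree_le e f" "sep_degree_le e g"
  shows "sep_degree_le e (\<lambda>x. f x + g x)"
  unfolding sep_degree_le_def
proof (intro allI)
  fix x :: "'a \<Rightarrow> real" and i
  obtain p where p: "degree p \<le> e" "\<forall>t. f (x(i := t)) = poly p t"
    using assms(1) unfolding sep_degree_le_def by blast
  obtain q where q: "degree q \<le> e" "\<forall>t. g (x(i := t)) = poly q t"
    using assms(2) unfolding sep_degree_le_def by blast
  show "\<exists>p. degree p \<le> e \<and> (\<forall>t. f (x(i := t)) + g (x(i := t)) = poly p t)"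
    using p q degree_add_le[of p e q] by (intro exI[of _ "p + q"]) auto
qed

lemma sep_degree_le_mult:
  assumes "sep_degree_le e f" "sep_degree_le e' g"
  shows "sep_degree_le (e + e') (\<lambda>x. f x * g x)"
  unfolding sep_degree_le_def
proof (intro allI)
  fix x :: "'a \<Rightarrow> real" and i
  obtain p where p: "degree p \<le> e" "\<forall>t. f (x(i := t)) = poly p t"
    using assms(1) unfolding sep_degree_le_def by blast
  obtain q where q: "degree q \<le> e'" "\<forall>t. g (x(i := t)) = poly q t"
    using assms(2) unfolding sep_degree_le_def by blast
  show "\<exists>p. degree p \<le> e + e' \<and> (\<forall>t. f (x(i := t)) * g (x(i := t)) = poly p t)"
    using p q degree_mult_le[of p q] by (intro exI[of _ "p * q"]) auto
qed

lemma sep_degree_le_sum: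
  assumes "\<And>a. a \<in> A \<Longrightarrow> sep_degree_le e (f a)"
  shows "sep_degree_le e (\<lambda>x. \<Sum>a\<in>A. f a x)"
  using assms
  by (induction A rule: infinite_finite_induct) (auto intro: sep_degree_le_const sep_degree_le_add)

lemma sep_degree_le_prod:
  assumes "\<And>a. a \<in> A \<Longrightarrow> sep_degree_le e (f a)"
  shows "sep_degree_le (card A * e) (\<lambda>x. \<Prod>a\<in>A. f a x)"
  using assms
proof (induction A rule: infinite_finite_induct)
  case (insert a A)
  then have "sep_degree_le (e + card A * e) (\<lambda>x. f a x * (\<Prod>a\<in>A. f a x))"
    by (intro sep_degree_le_mult) auto
  then show ?case using insert by simp
qed (auto intro: sep_degree_le_const)

lemma sep_degree_le_exists:
  assumes "f \<in> poly_funs (fun_coords I)"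
  shows "\<exists>e. sep_degree_le e f"
  using assms
proof (induction f rule: poly_funs.induct)
  case (coord f)
  then obtain i where i: "f = (\<lambda>x. x i)" by (auto simp: fun_coords_def)
  have "\<exists>p. degree p \<le> 1 \<and> (\<forall>t. f (x(j := t)) = poly p t)" for x j
  proof (cases "i = j")
    case True
    then show ?thesis using i by (intro exI[of _ "[:0, 1:]"]) simp
  next
    case False
    then show ?thesis using i by (intro exI[of _ "[:x i:]"]) simp
  qed
  then show ?case unfolding sep_degree_le_def by blast
next
  case (add f g)
  then obtain e e' where "sep_degree_le e f" "sep_degree_le e' g" by blast
  then have "sep_degree_le (max e e') (\<lambda>x. f x + g x)"
    by (intro sep_degree_le_add) (auto intro: sep_degree_le_mono)
  then show ?case ..
qed (auto intro: sep_degree_le_const sep_degree_le_mult)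

text \<open>Freezing one variable at any of the \<open>e + 1\<close> grid values leaves a function
  that vanishes by induction; in that variable f is then a polynomial of degree at most e with
  \<open>e + 1\<close> roots.\<close>

lemma sep_degree_le_grid_zero:
  assumes "finite I" "sep_degree_le e f"
    and "\<And>x. (\<forall>i\<in>I. x i \<in> real ` {..e}) \<Longrightarrow> (\<forall>i. i \<notin> I \<longrightarrow> x i = 0) \<Longrightarrow> f x = 0"
    and "\<And>i. i \<notin> I \<Longrightarrow> x i = 0"
  shows "f x = 0"
  using assms
proof (induction I arbitrary: f x rule: finite_induct)
  case empty
  then show ?case by auto
next
  case (insert i I)
  obtain p where p: "degree p \<le> e" "\<forall>t. f (x(i := t)) = poly p t"
    using insert.prems(1) unfolding sep_degree_le_def by blast
  have root: "poly p t = 0" if t: "t \<in> real ` {..e}" for t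
  proof -
    define f' where "f' = (\<lambda>x. f (x(i := t)))"
    have deg: "sep_degree_le e f'"
      unfolding sep_degree_le_def
    proof (intro allI)
      fix z :: "'a \<Rightarrow> real" and j
      show "\<exists>p. degree p \<le> e \<and> (\<forall>s. f' (z(j := s)) = poly p s)"
      proof (cases "j = i")
        case True
        then show ?thesis by (intro exI[of _ "[:f (z(i := t)):]"]) (simp add: f'_def)
      next
        case False
        obtain q where "degree q \<le> e" "\<forall>s. f ((z(i := t))(j := s)) = poly q s"
          using insert.prems(1) unfolding sep_degree_le_def by blast
        then show ?thesis using False
          by (intro exI[of _ q]) (auto simp: f'_def fun_upd_twist)
      qed
    qed
    have "f' (x(i := 0)) = 0"
    proof (rule insert.IH[OF deg])
      fix z :: "'a \<Rightarrow> real"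
      assume "\<forall>i\<in>I. z i \<in> real ` {..e}" "\<forall>i. i \<notin> I \<longrightarrow> z i = 0"
      then show "f' z = 0" unfolding f'_def
        using t by (intro insert.prems(2)) auto
    next
      fix j assume "j \<notin> I"
      then show "(x(i := 0)) j = 0" using insert.prems(3) by auto
    qed
    then show ?thesis using p by (simp add: f'_def)
  qed
  have "p = 0"
  proof (rule ccontr)
    assume "p \<noteq> 0"
    then have "card (real ` {..e}) \<le> card {t. poly p t = 0}"
      using root by (intro card_mono poly_roots_finite) auto
    also have "\<dots> \<le> degree p" by (rule card_poly_roots_bound) fact
    finally show False using p by (simp add: card_image)
  qed
  then show ?case using p(2) by (metis fun_upd_triv poly_0)
qed

text \<open>Gaussian elimination: an equation with a non-zero coefficient at \<open>a0\<close>
  serves to eliminate the unknown \<open>a0\<close> from the others, which leaves one equation and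
  one unknown less.\<close>

lemma homogeneous_system_nontrivial_solution:
  fixes w :: "'a \<Rightarrow> 'b \<Rightarrow> real"
  assumes "finite B" "finite A" "card B < card A"
  shows "\<exists>c. (\<exists>a\<in>A. c a \<noteq> 0) \<and> (\<forall>b\<in>B. (\<Sum>a\<in>A. c a * w a b) = 0)"
  using assms
proof (induction B arbitrary: A w rule: finite_induct)
  case empty
  then have "A \<noteq> {}" by auto
  then show ?case by (intro exI[of _ "\<lambda>_. 1"]) auto
next
  case (insert b B)
  show ?case
  proof (cases "\<forall>a\<in>A. w a b = 0")
    case True
    then show ?thesis using insert.IH[of A w] insert.prems insert.hyps by auto
  next
    case False
    then obtain a0 where a0: "a0 \<in> A" "w a0 b \<noteq> 0" by blast
    define A' where "A' = A - {a0}"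
    have A': "finite A'" "A = insert a0 A'" "a0 \<notin> A'" using a0 insert.prems by (auto simp: A'_def)
    have "card B < card A'" using A' insert by simp
    then obtain c where c: "\<exists>a\<in>A'. c a \<noteq> 0"
      "\<forall>b'\<in>B. (\<Sum>a\<in>A'. c a * (w a b' - w a b / w a0 b * w a0 b')) = 0"
      using insert.IH[OF A'(1), of "\<lambda>a b'. w a b' - w a b / w a0 b * w a0 b'"] by blast
    \<comment> \<open>The value that equation \<open>b\<close> forces on the eliminated
      unknown.\<close>
    define s where "s = - (\<Sum>a\<in>A'. c a * w a b) / w a0 b"
    have sum: "(\<Sum>a\<in>A. (c(a0 := s)) a * w a b') = s * w a0 b' + (\<Sum>a\<in>A'. c a * w a b')" for b'
      unfolding A'(2) using A' by (auto intro: sum.cong)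
    show ?thesis
    proof (intro exI[of _ "c(a0 := s)"] conjI ballI)
      show "\<exists>a\<in>A. (c(a0 := s)) a \<noteq> 0" using c(1) A' by auto
      fix b' assume "b' \<in> insert b B"
      then consider "b' = b" | "b' \<in> B" by blast
      then show "(\<Sum>a\<in>A. (c(a0 := s)) a * w a b') = 0"
      proof cases
        case 1
        show ?thesis unfolding 1 sum using a0 by (simp add: s_def)
      next
        case 2
        have "0 = (\<Sum>a\<in>A'. c a * w a b' - (c a * w a b) * (w a0 b' / w a0 b))"
          using c(2) 2 by (auto simp: algebra_simps)
        also have "\<dots> = (\<Sum>a\<in>A'. c a * w a b') + s * w a0 b'"
          unfolding sum_subtractf sum_distrib_right[symmetric] s_def by simp
        finally show ?thesis unfolding sum by simp
      qed
    qed
  qed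
qed

text \<open>The functions of degree at most \<open>T\<close> in each of the \<open>card K\<close> target variables, pulled back
  and multiplied by a power of \<open>h\<close>, are polynomials in \<open>card I\<close> variables of degree \<open>O(T)\<close>, hence
  linearly dependent for large \<open>T\<close>. Lagrange polynomials on a grid serve as a basis of the former,
  and polynomials of bounded degree are determined by their values on a grid.\<close>

lemma rational_image_annihilated:
  fixes g :: "'k \<Rightarrow> ('i \<Rightarrow> real) \<Rightarrow> real"
  assumes fin: "finite I" "finite K" and card: "card I < card K"
    and g: "\<And>k. k \<in> K \<Longrightarrow> g k \<in> poly_funs (fun_coords I)" and h: "h \<in> poly_funs (fun_coords I)"
  obtains F y where "F \<in> poly_funs (fun_coords K)" "F y \<noteq> 0"
    "\<And>x y. h x \<noteq> 0 \<Longrightarrow> (\<And>k. k \<in> K \<Longrightarrow> y k * h x = g k x) \<Longrightarrow> F y = 0"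
proof -
  define d where "d f = (LEAST e. sep_degree_le e f)" for f :: "('i \<Rightarrow> real) \<Rightarrow> real"
  have d: "sep_degree_le (d f) f" if "f \<in> poly_funs (fun_coords I)" for f
    unfolding d_def using sep_degree_le_exists[OF that] by (rule LeastI_ex)
  define e where "e = d h + (\<Sum>k\<in>K. d (g k))"
  have h_deg: "sep_degree_le e h"
    by (rule sep_degree_le_mono[OF d[OF h]]) (simp add: e_def)
  have g_deg: "sep_degree_le e (g k)" if "k \<in> K" for k
    using member_le_sum[of k K "\<lambda>k. d (g k)"] that fin
    by (intro sep_degree_le_mono[OF d[OF g[OF that]]]) (simp add: e_def)
  \<comment> \<open>\<open>E\<close> bounds the degree of the pulled back functions:
    \<open>card K\<close> groups of \<open>T\<close> factors of degree at most \<open>e\<close>.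
    Since E + 1 is at most (card K * e + 1) * (T + 1), this \<open>T\<close> makes the grid
    \<open>B\<close> have at most T * (T + 1) ^ card I points, fewer than the (T + 1) ^ card K
    elements of \<open>A\<close>.\<close>
  define T where "T = (card K * e + 1) ^ card I"
  define E where "E = card K * (T * e)"
  define A where "A = (\<Pi>\<^sub>E k\<in>K. {..T})"
  define B where "B = (\<Pi>\<^sub>E i\<in>I. {..E})"
  define pt where "pt b = (\<lambda>i. if i \<in> I then real (b i) else 0)" for b :: "'i \<Rightarrow> nat"
  \<comment> \<open>\<open>L a\<close> is the Lagrange product of the grid point \<open>a\<close>,
    up to normalization; \<open>M a\<close> is \<open>L a\<close> at the quotients
    \<open>g k x / h x\<close>, cleared of denominators by
    \<open>h x ^ (card K * T)\<close>.\<close>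
  define M where "M a x = (\<Prod>k\<in>K. \<Prod>b\<in>{..T} - {a k}. g k x - real b * h x)" for a x
  define L where "L a y = (\<Prod>k\<in>K. \<Prod>b\<in>{..T} - {a k}. y k - real b)" for a :: "'k \<Rightarrow> nat" and y
  have finAB: "finite A" "finite B" using fin by (auto simp: A_def B_def intro: finite_PiE)
  have "E + 1 \<le> (card K * e + 1) * (T + 1)" by (simp add: E_def algebra_simps)
  then have "(E + 1) ^ card I \<le> ((card K * e + 1) * (T + 1)) ^ card I" by (rule power_mono) simp
  also have "\<dots> = T * (T + 1) ^ card I" by (simp only: power_mult_distrib T_def[symmetric])
  also have "\<dots> < (T + 1) ^ (card I + 1)" by simp
  also have "\<dots> \<le> (T + 1) ^ card K" using card by (intro power_increasing) auto
  finally have "card B < card A" using fin by (simp add: A_def B_def card_PiE)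
  then obtain c where c: "\<exists>a\<in>A. c a \<noteq> 0" "\<forall>b\<in>B. (\<Sum>a\<in>A. c a * M a (pt b)) = 0"
    using homogeneous_system_nontrivial_solution[OF finAB(2,1), of "\<lambda>a b. M a (pt b)"] by blast
  define F where "F y = (\<Sum>a\<in>A. c a * L a y)" for y
  have M_deg: "sep_degree_le E (M a)" if "a \<in> A" for a
    unfolding M_def E_def
  proof (rule sep_degree_le_prod)
    fix k assume k: "k \<in> K"
    then have "card ({..T} - {a k}) = T" using that by (auto simp: A_def PiE_iff)
    moreover have "sep_degree_le e (\<lambda>x. g k x - real b * h x)" for b
      using sep_degree_le_add[OF g_deg[OF k] sep_degree_le_mult[OF sep_degree_le_const[of 0 "- real b"] h_deg, simplified]]
      by simp
    ultimately show "sep_degree_le (T * e) (\<lambda>x. \<Prod>b\<in>{..T} - {a k}. g k x - real b * h x)"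
      using sep_degree_le_prod[of "{..T} - {a k}" e "\<lambda>b x. g k x - real b * h x"] by simp
  qed
  define H where "H x = (\<Sum>a\<in>A. c a * M a x)" for x
  have H_deg: "sep_degree_le E H" unfolding H_def
    by (intro sep_degree_le_sum)
       (use sep_degree_le_mult[OF sep_degree_le_const[of 0] M_deg] in auto)
  have H_poly: "H \<in> poly_funs (fun_coords I)" unfolding H_def[abs_def] M_def
    by (intro poly_funs_sum poly_funs.mult poly_funs_prod poly_funs_diff poly_funs.const g h)
  have H0: "H x = 0" if "\<And>i. i \<notin> I \<Longrightarrow> x i = 0" for x
  proof (rule sep_degree_le_grid_zero[OF fin(1) H_deg _ that])
    fix x :: "'i \<Rightarrow> real"
    assume x: "\<forall>i\<in>I. x i \<in> real ` {..E}" "\<forall>i. i \<notin> I \<longrightarrow> x i = 0"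
    define b where "b = restrict (\<lambda>i. nat \<lfloor>x i\<rfloor>) I"
    have "b \<in> B" using x by (fastforce simp: B_def b_def)
    moreover have "pt b = x" using x by (fastforce simp: pt_def b_def)
    ultimately show "H x = 0" using c(2) by (auto simp: H_def)
  qed auto
  have H: "H x = 0" for x
  proof -
    have "H x = H (\<lambda>i. if i \<in> I then x i else 0)"
      by (rule poly_funs_fun_coords_cong[OF H_poly]) auto
    then show ?thesis using H0 by simp
  qed
  obtain a where a: "a \<in> A" "c a \<noteq> 0" using c by blast
  \<comment> \<open>At the grid point \<open>a\<close> every other Lagrange product vanishes, so
    \<open>F\<close> takes the value \<open>c a * L a\<close> there; this shows that
    \<open>F\<close> is not the zero function.\<close>
  have zero: "L a' (\<lambda>k. real (a k)) = 0" if a': "a' \<in> A" "a' \<noteq> a" for a'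
  proof -
    obtain k where k: "k \<in> K" "a' k \<noteq> a k" using a' a PiE_ext unfolding A_def by metis
    then have "a k \<in> {..T} - {a' k}" using a by (auto simp: A_def PiE_iff)
    then have "(\<Prod>b\<in>{..T} - {a' k}. real (a k) - real b) = 0"
      by (intro prod_zero) auto
    then show ?thesis unfolding L_def using k fin by (intro prod_zero) auto
  qed
  have "L a (\<lambda>k. real (a k)) \<noteq> 0" unfolding L_def using fin by auto
  moreover have "F (\<lambda>k. real (a k)) = c a * L a (\<lambda>k. real (a k))"
    unfolding F_def using a finAB zero by (subst sum.remove[of _ a]) (auto intro!: sum.neutral)
  ultimately have "F (\<lambda>k. real (a k)) \<noteq> 0" using a by simp
  moreover have "F \<in> poly_funs (fun_coords K)" unfolding F_def[abs_def] L_def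
    by (intro poly_funs_sum poly_funs.mult poly_funs_prod poly_funs_diff poly_funs.const
        fun_coords_poly_funs)
  moreover have "F y = 0" if hx: "h x \<noteq> 0" and y: "\<And>k. k \<in> K \<Longrightarrow> y k * h x = g k x" for x y
  proof -
    have "M a x = h x ^ (card K * T) * L a y" if "a \<in> A" for a
    proof -
      have "(\<Prod>b\<in>{..T} - {a k}. g k x - real b * h x) = h x ^ T * (\<Prod>b\<in>{..T} - {a k}. y k - real b)"
        if k: "k \<in> K" for k
      proof -
        have "(\<Prod>b\<in>{..T} - {a k}. g k x - real b * h x) = (\<Prod>b\<in>{..T} - {a k}. h x * (y k - real b))"
          using y[OF k] by (intro prod.cong) (auto simp: algebra_simps)
        moreover have "card ({..T} - {a k}) = T" using k \<open>a \<in> A\<close> by (auto simp: A_def PiE_iff)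
        ultimately show ?thesis by (simp add: prod.distrib)
      qed
      then show ?thesis
        by (simp add: M_def L_def prod.distrib power_mult mult.commute)
    qed
    then have "H x = h x ^ (card K * T) * F y"
      unfolding H_def F_def sum_distrib_left by (intro sum.cong) auto
    then show ?thesis using H hx by simp
  qed
  ultimately show thesis using that[of F "\<lambda>k. real (a k)"] by blast
qed

section \<open>Generic sequences\<close>

text \<open>An open condition on the whole tuple can be met by successive choices. The first vector
  is taken where \<open>F\<close>, with the remaining vectors frozen at those of \<open>y\<close>,
  is non-zero; the same frozen vectors then witness that the condition left for the others is not
  void.\<close>

lemma generic_seq_inI:
  assumes "F \<in> poly_funs (fun_coords ({..<N} \<times> {..<d}))" "F y \<noteq> 0"
    and "\<And>cs. length cs = N \<Longrightarrow> set cs \<subseteq> carrier_vec d \<Longrightarrow> F (\<lambda>(k, i). cs ! k $ i) \<noteq> 0 \<Longrightarrow> P cs"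
  shows "generic_seq_in (vec_coords d) (carrier_vec d) N P"
  using assms
proof (induction N arbitrary: F y P)
  case 0
  have "F (\<lambda>(k, i). [] ! k $ i) = F y"
    by (rule poly_funs_fun_coords_cong[OF 0(1)]) auto
  then show ?case using 0 by auto
next
  case (Suc N)
  define cons where "cons c z = (\<lambda>(k, i). case k of 0 \<Rightarrow> c $ i | Suc k' \<Rightarrow> z (k', i))"
    for c :: "real vec" and z :: "nat \<times> nat \<Rightarrow> real"
  define z where "z = (\<lambda>(k, i). y (Suc k, i))"
  define U where "U = {c \<in> carrier_vec d. F (cons c z) \<noteq> 0}"
  have "(\<lambda>c. F (cons c z)) \<in> poly_funs (vec_coords d)"
  proof (rule poly_funs_comp[OF Suc.prems(1)])
    fix g :: "(nat \<times> nat \<Rightarrow> real) \<Rightarrow> real"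
    assume "g \<in> fun_coords ({..<Suc N} \<times> {..<d})"
    then obtain k i where g: "g = (\<lambda>x. x (k, i))" "i < d" by (auto simp: fun_coords_def)
    show "(\<lambda>c. g (cons c z)) \<in> poly_funs (vec_coords d)"
      using g by (cases k) (auto simp: cons_def vec_coords_def intro!: poly_funs.const poly_funs.coord)
  qed
  then have "zariski_open_in (vec_coords d) (carrier_vec d) U"
    unfolding zariski_open_in_def U_def by (intro exI[of _ "{\<lambda>c. F (cons c z)}"]) auto
  moreover have "F (cons (vec d (\<lambda>i. y (0, i))) z) = F y"
    by (rule poly_funs_fun_coords_cong[OF Suc.prems(1)])
       (auto simp: cons_def z_def split: nat.splits)
  then have "vec d (\<lambda>i. y (0, i)) \<in> U" using Suc.prems(2) by (simp add: U_def)
  moreover have "generic_seq_in (vec_coords d) (carrier_vec d) N (\<lambda>cs. P (c # cs))" if c: "c \<in> U" for c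
  proof (rule Suc.IH)
    show "(\<lambda>x. F (cons c x)) \<in> poly_funs (fun_coords ({..<N} \<times> {..<d}))"
    proof (rule poly_funs_comp[OF Suc.prems(1)])
      fix g :: "(nat \<times> nat \<Rightarrow> real) \<Rightarrow> real"
      assume "g \<in> fun_coords ({..<Suc N} \<times> {..<d})"
      then obtain k i where g: "g = (\<lambda>x. x (k, i))" "i < d" "k < Suc N" by (auto simp: fun_coords_def)
      show "(\<lambda>x. g (cons c x)) \<in> poly_funs (fun_coords ({..<N} \<times> {..<d}))"
        using g by (cases k) (auto simp: cons_def intro!: poly_funs.const fun_coords_poly_funs)
    qed
    show "F (cons c z) \<noteq> 0" using c by (simp add: U_def)
    fix cs :: "real vec list"
    assume cs: "length cs = N" "set cs \<subseteq> carrier_vec d" "F (cons c (\<lambda>(k, i). cs ! k $ i)) \<noteq> 0"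
    have "cons c (\<lambda>(k, i). cs ! k $ i) = (\<lambda>(k, i). (c # cs) ! k $ i)"
      by (auto simp: cons_def fun_eq_iff split: nat.splits)
    then show "P (c # cs)" using cs c by (intro Suc.prems(3)) (auto simp: U_def)
  qed
  ultimately show ?case unfolding generic_seq_in.simps generic_in_def by blast
qed

section \<open>Power sums\<close>

text \<open>Newton's identities, as the logarithmic derivative of the generating function of the
  elementary symmetric functions.\<close>

lemma fps_deriv_prod_linear:
  fixes x :: "'a \<Rightarrow> real"
  assumes "finite A"
  shows "fps_deriv (\<Prod>a\<in>A. 1 - fps_const (x a) * fps_X) =
    - ((\<Prod>a\<in>A. 1 - fps_const (x a) * fps_X) * Abs_fps (\<lambda>k. \<Sum>a\<in>A. x a ^ Suc k))"
  using assms
proof (induction A rule: finite_induct)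
  case empty
  have "Abs_fps (\<lambda>k. 0) = (0 :: real fps)" by (simp add: fps_eq_iff)
  then show ?case by simp
next
  case (insert a A)
  let ?f = "\<Prod>a\<in>A. 1 - fps_const (x a) * fps_X"
  let ?P = "Abs_fps (\<lambda>k. \<Sum>a\<in>A. x a ^ Suc k)"
  let ?G = "Abs_fps (\<lambda>k. x a ^ Suc k)"
  \<comment> \<open>\<open>?G\<close> is the geometric series of x a / (1 - x a * X), the
    contribution of \<open>a\<close> to the logarithmic derivative up to sign.\<close>
  have G: "(1 - fps_const (x a) * fps_X) * ?G = fps_const (x a)"
  proof (rule fps_ext)
    fix k
    show "fps_nth ((1 - fps_const (x a) * fps_X) * ?G) k = fps_nth (fps_const (x a)) k"
      by (cases k) (simp_all add: left_diff_distrib mult.assoc)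
  qed
  have "Abs_fps (\<lambda>k. \<Sum>a\<in>insert a A. x a ^ Suc k) = ?G + ?P"
    using insert by (simp add: fps_eq_iff)
  then have "(1 - fps_const (x a) * fps_X) * ?f * Abs_fps (\<lambda>k. \<Sum>a\<in>insert a A. x a ^ Suc k)
     = (1 - fps_const (x a) * fps_X) * ?G * ?f + (1 - fps_const (x a) * fps_X) * (?f * ?P)"
    by (simp add: algebra_simps)
  then show ?case using insert unfolding G
    by (simp add: algebra_simps)
qed

text \<open>Comparing coefficients in f' = - f * P gives Newton's recursion: (l + 1) times
  coefficient l + 1 of f is minus the sum of f_i * P_(l - i). So the constant term and the first
  \<open>d\<close> coefficients of P determine those of f up to \<open>d\<close>.\<close>

lemma fps_eq_if_log_deriv_eq:
  fixes f g :: "real fps"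
  assumes f: "fps_deriv f = - (f * P)" and g: "fps_deriv g = - (g * Q)"
    and "fps_nth f 0 = fps_nth g 0" "\<And>k. k < d \<Longrightarrow> fps_nth P k = fps_nth Q k" "k \<le> d"
  shows "fps_nth f k = fps_nth g k"
  using assms(5)
proof (induction k rule: less_induct)
  case (less k)
  show ?case
  proof (cases k)
    case 0
    then show ?thesis using assms by simp
  next
    case (Suc l)
    have "real (Suc l) * fps_nth f (Suc l) = - (\<Sum>i=0..l. fps_nth f i * fps_nth P (l - i))"
      using arg_cong[OF f, of "\<lambda>h. fps_nth h l"] by (simp add: fps_mult_nth)
    also have "\<dots> = - (\<Sum>i=0..l. fps_nth g i * fps_nth Q (l - i))"
      using less Suc assms(4) by (intro arg_cong[of _ _ uminus] sum.cong) auto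
    also have "\<dots> = real (Suc l) * fps_nth g (Suc l)"
      using arg_cong[OF g, of "\<lambda>h. fps_nth h l"] by (simp add: fps_mult_nth)
    finally show ?thesis using Suc by simp
  qed
qed

lemma fps_prod_linear_poly:
  "(\<Prod>a\<in>A. 1 - fps_const (x a :: real) * fps_X) = fps_of_poly (\<Prod>a\<in>A. [:1, - x a:])"
  by (simp add: fps_of_poly_prod fps_of_poly_linear' flip: fps_const_neg)

text \<open>The power sums determine the product of the factors 1 - x a * X, in which zero values
  leave no trace. The reversed polynomial \<open>q\<close>, of known degree \<open>card A\<close>,
  has all values as roots with multiplicity, zeros included.\<close>

lemma image_mset_eq_if_power_sums_eq:
  fixes x y :: "'a \<Rightarrow> real"
  assumes fin: "finite A" and eq: "\<And>\<nu>. 1 \<le> \<nu> \<Longrightarrow> \<nu> \<le> card A \<Longrightarrow> (\<Sum>a\<in>A. x a ^ \<nu>) = (\<Sum>a\<in>A. y a ^ \<nu>)"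
  shows "image_mset x (mset_set A) = image_mset y (mset_set A)"
proof -
  let ?f = "\<lambda>x. \<Prod>a\<in>A. 1 - fps_const (x a) * fps_X :: real fps"
  let ?p = "\<lambda>x. \<Prod>a\<in>A. [:1, - x a:] :: real poly"
  have deg: "degree (?p x) \<le> card A" for x :: "'a \<Rightarrow> real"
  proof -
    have "degree (?p x) \<le> (\<Sum>a\<in>A. degree [:1, - x a:])" using degree_prod_sum_le[OF fin, of "\<lambda>a. [:1, - x a:]"] by (simp add: o_def)
    also have "\<dots> \<le> (\<Sum>a\<in>A. 1)" by (intro sum_mono) auto
    finally show ?thesis by simp
  qed
  have "coeff (?p x) k = coeff (?p y) k" for k
  proof (cases "k \<le> card A")
    case True
    have "fps_nth (?f x) k = fps_nth (?f y) k"
    proof (rule fps_eq_if_log_deriv_eq[OF fps_deriv_prod_linear[OF fin] fps_deriv_prod_linear[OF fin] _ _ True])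
      show "fps_nth (?f x) 0 = fps_nth (?f y) 0" by (simp add: fps_prod_linear_poly poly_0_coeff_0[symmetric] poly_prod)
      show "fps_nth (Abs_fps (\<lambda>k. \<Sum>a\<in>A. x a ^ Suc k)) k = fps_nth (Abs_fps (\<lambda>k. \<Sum>a\<in>A. y a ^ Suc k)) k"
        if "k < card A" for k using eq[of "Suc k"] that by simp
    qed
    then show ?thesis by (simp add: fps_prod_linear_poly)
  next
    case False
    then show ?thesis using deg[of x] deg[of y] by (simp add: coeff_eq_0)
  qed
  then have p: "?p x = ?p y" by (rule poly_eqI)
  define q where "q x = (\<Prod>a\<in>A. [:- x a, 1:])" for x :: "'a \<Rightarrow> real"
  have q_eq: "poly (q x) s = s ^ card A * poly (?p x) (1 / s)" if "s \<noteq> 0" for s and x :: "'a \<Rightarrow> real"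
  proof -
    have "poly (q x) s = (\<Prod>a\<in>A. s * (1 - x a / s))"
      unfolding q_def poly_prod using that by (intro prod.cong) (auto simp: right_diff_distrib)
    then show ?thesis by (simp add: prod.distrib poly_prod)
  qed
  have "q x = q y"
  proof (rule ccontr)
    assume "q x \<noteq> q y"
    then have "finite {s. poly (q x - q y) s = 0}" by (intro poly_roots_finite) simp
    moreover have "- {0} \<subseteq> {s. poly (q x - q y) s = 0}" using q_eq p by auto
    ultimately have "finite (- {0 :: real})" by (rule rev_finite_subset)
    then show False using infinite_UNIV_char_0[where 'a = real] by (simp add: Compl_eq_Diff_UNIV)
  qed
  moreover have "proots (q x) = image_mset x (mset_set A)" for x :: "'a \<Rightarrow> real"
    unfolding q_def by (subst proots_prod) (auto simp: sum_unfold_sum_mset)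
  ultimately show ?thesis by metis
qed

section \<open>Rank and factorizations\<close>

lemma rank_le_if_factorization:
  fixes Z :: "real mat"
  assumes "Z \<in> carrier_mat m n" "\<And>i j. i < m \<Longrightarrow> j < n \<Longrightarrow> Z $$ (i, j) = (\<Sum>l<k. a i l * b l j)"
  shows "vec_space.rank m Z \<le> k"
  using assms
proof (induction k arbitrary: Z)
  case 0
  then have "Z = 0\<^sub>m m n" by (intro eq_matI) auto
  then show ?case using vec_space.rank_0I by simp
next
  case (Suc k)
  define V where "V = mat m n (\<lambda>(i, j). \<Sum>l<k. a i l * b l j)"
  define W where "W = mat m n (\<lambda>(i, j). a i k * b k j)"
  have "Z = V + W" using Suc.prems by (intro eq_matI) (auto simp: V_def W_def)
  then have "vec_space.rank m Z \<le> vec_space.rank m V + vec_space.rank m W"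
    by (simp add: V_def W_def vec_space.rank_subadditive[where nc = n])
  moreover have "vec_space.rank m V \<le> k" by (rule Suc.IH) (auto simp: V_def)
  moreover have "vec_space.rank m W \<le> 1"
    by (rule vec_space.rank_le_1_product_entries[where nc = n and f = "\<lambda>i. a i k" and g = "b k"])
       (auto simp: W_def)
  ultimately show ?case by simp
qed

text \<open>A rank factorization whose left factor consists of columns of Z itself. An arbitrary one
  would have r * (m + n) parameters; here the coefficients of the columns in \<open>J\<close> are
  trivial, which saves the r * r parameters that the dimension count cannot afford.\<close>

lemma rank_column_basis:
  fixes Z :: "real mat"
  assumes Z: "Z \<in> carrier_mat m n"
  obtains J u where "J \<subseteq> {..<n}" "card J = vec_space.rank m Z"
    "\<And>i j. i < m \<Longrightarrow> j < n \<Longrightarrow> Z $$ (i, j) = (\<Sum>j'\<in>J. Z $$ (i, j') * u j' j)"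
proof -
  interpret V: vec_space "TYPE(real)" m .
  let ?P = "\<lambda>T. T \<subseteq> set (cols Z) \<and> V.lin_indpt T"
  have cols: "set (cols Z) \<subseteq> carrier_vec m" using cols_dim[of Z] Z by auto
  have "V.lin_indpt {}" by (simp add: V.lin_dep_def)
  then obtain S where S: "finite S" "maximal S ?P"
    using maximal_exists_superset[of "set (cols Z)" ?P "{}"] by auto
  have S': "S \<subseteq> set (cols Z)" "V.lin_indpt S" using S by (auto simp: maximal_def)
  have Sm: "S \<subseteq> carrier_vec m" using S' cols by blast
  have rank: "V.rank Z = card S" by (rule V.rank_card_indpt[OF Z S(2)])
  have span: "c \<in> V.span S" if c: "c \<in> set (cols Z)" for c
  proof (rule ccontr)
    assume n: "c \<notin> V.span S"
    have "c \<notin> S" using n Sm V.span_mem by auto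
    moreover have "V.lin_indpt (insert c S)"
      using V.lin_dep_iff_in_span[of S c] S' n c cols Sm \<open>c \<notin> S\<close> by auto
    ultimately show False using S(2) S' c by (auto simp: maximal_def)
  qed
  have "S \<subseteq> col Z ` {..<n}" using S' Z by (auto simp: cols_def atLeast0LessThan)
  then have "\<exists>j<n. col Z j = c" if "c \<in> S" for c using that by blast
  then obtain \<iota> where \<iota>: "\<And>c. c \<in> S \<Longrightarrow> \<iota> c < n \<and> col Z (\<iota> c) = c" by metis
  have inj: "inj_on \<iota> S" by (metis \<iota> inj_onI)
  have "\<exists>u. col Z j = V.lincomb u S" if "j < n" for j
  proof -
    have "col Z j \<in> set (cols Z)" using that Z by (auto simp: cols_def)
    then show ?thesis using span V.finite_span[OF S(1) Sm] by auto
  qed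
  then obtain u where u: "\<And>j. j < n \<Longrightarrow> col Z j = V.lincomb (u j) S" by metis
  show thesis
  proof (rule that[of "\<iota> ` S" "\<lambda>j' j. u j (col Z j')"])
    show "\<iota> ` S \<subseteq> {..<n}" using \<iota> by auto
    show "card (\<iota> ` S) = V.rank Z" using inj rank by (simp add: card_image)
    fix i j assume ij: "i < m" "j < n"
    have "Z $$ (i, j) = V.lincomb (u j) S $ i" using ij Z u by (metis carrier_matD index_col)
    also have "\<dots> = (\<Sum>c\<in>S. u j c * c $ i)" by (rule V.lincomb_index[OF ij(1) Sm])
    also have "\<dots> = (\<Sum>c\<in>S. Z $$ (i, \<iota> c) * u j (col Z (\<iota> c)))"
    proof (rule sum.cong)
      fix c assume c: "c \<in> S"
      then have "c $ i = Z $$ (i, \<iota> c)" using \<iota>[OF c] ij Z by (metis carrier_matD index_col)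
      then show "u j c * c $ i = Z $$ (i, \<iota> c) * u j (col Z (\<iota> c))" using \<iota>[OF c] by simp
    qed simp
    also have "\<dots> = (\<Sum>j'\<in>\<iota> ` S. Z $$ (i, j') * u j (col Z j'))"
      using inj by (simp add: sum.reindex)
    finally show "Z $$ (i, j) = (\<Sum>j'\<in>\<iota> ` S. Z $$ (i, j') * u j (col Z j'))" .
  qed
qed

text \<open>In this form the rank bound is visibly stable under reindexing, transposition and
  polynomial deformation of the two factors.\<close>

lemma rank_le_iff_factorization:
  fixes Z :: "real mat"
  assumes Z: "Z \<in> carrier_mat m n"
  shows "vec_space.rank m Z \<le> k \<longleftrightarrow>
    (\<exists>a b. \<forall>i<m. \<forall>j<n. Z $$ (i, j) = (\<Sum>l<k. a i l * b l j))" (is "_ \<longleftrightarrow> ?R")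
proof
  assume le: "vec_space.rank m Z \<le> k"
  obtain J u where J: "J \<subseteq> {..<n}" "card J = vec_space.rank m Z"
    "\<And>i j. i < m \<Longrightarrow> j < n \<Longrightarrow> Z $$ (i, j) = (\<Sum>j'\<in>J. Z $$ (i, j') * u j' j)"
    using rank_column_basis[OF Z] by metis
  have "finite J" using J(1) finite_subset by blast
  then obtain f where f: "bij_betw f {..<card J} J"
    using ex_bij_betw_nat_finite[of J] by (auto simp: atLeast0LessThan)
  have "Z $$ (i, j) = (\<Sum>l<k. Z $$ (i, f l) * (if l < card J then u (f l) j else 0))"
    if "i < m" "j < n" for i j
  proof -
    have "Z $$ (i, j) = (\<Sum>l<card J. Z $$ (i, f l) * u (f l) j)"
      using J(3)[OF that] sum.reindex_bij_betw[OF f, of "\<lambda>j'. Z $$ (i, j') * u j' j"] by simp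
    also have "\<dots> = (\<Sum>l<k. Z $$ (i, f l) * (if l < card J then u (f l) j else 0))"
      using le J(2) by (intro sum.mono_neutral_cong_left) auto
    finally show ?thesis .
  qed
  then show ?R
    by (intro exI[of _ "\<lambda>i l. Z $$ (i, f l)"] exI[of _ "\<lambda>l j. if l < card J then u (f l) j else 0"]
        allI impI)
next
  assume ?R
  then show "vec_space.rank m Z \<le> k" using rank_le_if_factorization[OF Z] by blast
qed

lemma rank_le_reindex:
  fixes X Z :: "real mat"
  assumes X: "X \<in> carrier_mat m n" and Z: "Z \<in> carrier_mat m n"
    and "\<And>i j. i < m \<Longrightarrow> j < n \<Longrightarrow> \<sigma> i < m \<and> \<tau> j < n \<and> Z $$ (i, j) = X $$ (\<sigma> i, \<tau> j)"
  shows "vec_space.rank m Z \<le> vec_space.rank m X"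
proof -
  obtain a b where ab: "\<forall>i<m. \<forall>j<n. X $$ (i, j) = (\<Sum>l<vec_space.rank m X. a i l * b l j)"
    using rank_le_iff_factorization[OF X] by blast
  then show ?thesis unfolding rank_le_iff_factorization[OF Z]
    using assms(3) by (intro exI[of _ "\<lambda>i. a (\<sigma> i)"] exI[of _ "\<lambda>l j. b l (\<tau> j)"]) simp
qed

lemma rank_le_transpose:
  fixes X :: "real mat"
  assumes X: "X \<in> carrier_mat m m"
  shows "vec_space.rank m (X\<^sup>T) \<le> vec_space.rank m X"
proof -
  obtain a b where ab: "\<forall>i<m. \<forall>j<m. X $$ (i, j) = (\<Sum>l<vec_space.rank m X. a i l * b l j)"
    using rank_le_iff_factorization[OF X] by blast
  have XT: "X\<^sup>T \<in> carrier_mat m m" using X by simp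
  show ?thesis unfolding rank_le_iff_factorization[OF XT]
    using ab X by (intro exI[of _ "\<lambda>i l. b l i"] exI[of _ "\<lambda>l j. a j l"]) (simp add: mult.commute)
qed

text \<open>The submatrix factors through dimension r. A zero column and a zero row make the factors
  square, so that determinants multiply, and the left one kills the last unit vector.\<close>

lemma minor_zero_if_rank_le:
  fixes Z :: "real mat"
  assumes Z: "Z \<in> carrier_mat m n" and rank: "vec_space.rank m Z \<le> r"
    and \<rho>: "\<And>s. s < Suc r \<Longrightarrow> \<rho> s < m \<and> \<kappa> s < n"
  shows "det (mat (Suc r) (Suc r) (\<lambda>(s, t). Z $$ (\<rho> s, \<kappa> t))) = 0"
proof -
  obtain a b where ab: "\<forall>i<m. \<forall>j<n. Z $$ (i, j) = (\<Sum>l<r. a i l * b l j)"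
    using rank_le_iff_factorization[OF Z] rank by blast
  define A where "A = mat (Suc r) (Suc r) (\<lambda>(s, l). if l < r then a (\<rho> s) l else 0)"
  define B where "B = mat (Suc r) (Suc r) (\<lambda>(l, t). if l < r then b l (\<kappa> t) else 0)"
  have AB: "A \<in> carrier_mat (Suc r) (Suc r)" "B \<in> carrier_mat (Suc r) (Suc r)"
    by (auto simp: A_def B_def)
  have "A *\<^sub>v unit_vec (Suc r) r = 0\<^sub>v (Suc r)"
    by (rule eq_vecI) (auto simp: A_def)
  then have "det A = 0"
    using det_0_iff_vec_prod_zero_field[OF AB(1)]
    by (metis lessI unit_vec_carrier unit_vec_nonzero)
  moreover have "mat (Suc r) (Suc r) (\<lambda>(s, t). Z $$ (\<rho> s, \<kappa> t)) = A * B"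
    by (rule eq_matI)
       (auto simp: A_def B_def scalar_prod_def ab \<rho> atLeast0LessThan intro!: sum.cong)
  ultimately show ?thesis using det_mult[OF AB] by simp
qed

text \<open>The segment between two matrices may leave the variety; interpolating the two factors of
  their factorizations stays inside it and gives entries quadratic in the parameter.\<close>

lemma curve_connected_rank_le_variety:
  "curve_connected (mat_coords m n) (rank_le_variety m n r)"
  unfolding curve_connected_def
proof (intro ballI)
  fix X Y assume "X \<in> rank_le_variety m n r" "Y \<in> rank_le_variety m n r"
  then have X: "X \<in> carrier_mat m n" "vec_space.rank m X \<le> r"
    and Y: "Y \<in> carrier_mat m n" "vec_space.rank m Y \<le> r"
    by (auto simp: rank_le_variety_def)
  obtain a b where ab: "\<forall>i<m. \<forall>j<n. X $$ (i, j) = (\<Sum>l<r. a i l * b l j)"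
    using rank_le_iff_factorization[OF X(1)] X(2) by blast
  obtain c d where cd: "\<forall>i<m. \<forall>j<n. Y $$ (i, j) = (\<Sum>l<r. c i l * d l j)"
    using rank_le_iff_factorization[OF Y(1)] Y(2) by blast
  define \<gamma> where "\<gamma> t = mat m n (\<lambda>(i, j). \<Sum>l<r. (a i l + t * (c i l - a i l)) * (b l j + t * (d l j - b l j)))"
    for t :: real
  show "\<exists>\<gamma>. \<gamma> (0::real) = X \<and> \<gamma> 1 = Y \<and> range \<gamma> \<subseteq> rank_le_variety m n r \<and>
     (\<forall>g\<in>mat_coords m n. \<exists>p. \<forall>t. g (\<gamma> t) = poly p t)"
  proof (intro exI[of _ \<gamma>] conjI ballI)
    show "\<gamma> 0 = X" using X ab by (intro eq_matI) (auto simp: \<gamma>_def)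
    show "\<gamma> 1 = Y" using Y cd by (intro eq_matI) (auto simp: \<gamma>_def)
    have \<gamma>: "\<gamma> t \<in> carrier_mat m n" for t by (simp add: \<gamma>_def)
    have "vec_space.rank m (\<gamma> t) \<le> r" for t
      unfolding rank_le_iff_factorization[OF \<gamma>]
      by (intro exI[of _ "\<lambda>i l. a i l + t * (c i l - a i l)"] exI[of _ "\<lambda>l j. b l j + t * (d l j - b l j)"])
         (simp add: \<gamma>_def)
    then show "range \<gamma> \<subseteq> rank_le_variety m n r" using \<gamma> by (auto simp: rank_le_variety_def)
    fix g assume "g \<in> mat_coords m n"
    then obtain i j where g: "g = (\<lambda>Z. Z $$ (i, j))" "i < m" "j < n" by (auto simp: mat_coords_def)
    define p where "p l = [:a i l, c i l - a i l:]" for l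
    define q where "q l = [:b l j, d l j - b l j:]" for l
    have pq: "poly (p l) t = a i l + t * (c i l - a i l)" "poly (q l) t = b l j + t * (d l j - b l j)"
      for l t by (simp_all add: p_def q_def)
    show "\<exists>p. \<forall>t. g (\<gamma> t) = poly p t"
      using g by (intro exI[of _ "\<Sum>l<r. p l * q l"]) (simp add: \<gamma>_def poly_sum pq)
  qed
qed

section \<open>Permutations of the entries that preserve the rank\<close>

definition collinear_cells :: "nat \<times> nat \<Rightarrow> nat \<times> nat \<Rightarrow> bool" where
  "collinear_cells c d \<longleftrightarrow> fst c = fst d \<or> snd c = snd d"

text \<open>Call an edge of the rook graph horizontal or vertical. Two neighbours of a cell are collinear iff
  they are joined to it by edges of the same type, so at each cell \<open>\<pi>\<close> either keeps or swaps the
  types; by connectedness it does the same at all cells.\<close>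

lemma collinear_permutation_cases:
  fixes \<pi> :: "nat \<times> nat \<Rightarrow> nat \<times> nat"
  assumes \<pi>: "\<pi> permutes ({..<m} \<times> {..<n})" and mn: "m \<ge> 2" "n \<ge> 2"
    and col: "\<forall>c\<in>{..<m} \<times> {..<n}. \<forall>d\<in>{..<m} \<times> {..<n}.
      collinear_cells (\<pi> c) (\<pi> d) \<longleftrightarrow> collinear_cells c d"
  obtains (keep) "\<forall>c\<in>{..<m} \<times> {..<n}. \<forall>d\<in>{..<m} \<times> {..<n}.
      (fst c = fst d \<longrightarrow> fst (\<pi> c) = fst (\<pi> d)) \<and> (snd c = snd d \<longrightarrow> snd (\<pi> c) = snd (\<pi> d))"
  | (swap) "\<forall>c\<in>{..<m} \<times> {..<n}. \<forall>d\<in>{..<m} \<times> {..<n}.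
      (fst c = fst d \<longrightarrow> snd (\<pi> c) = snd (\<pi> d)) \<and> (snd c = snd d \<longrightarrow> fst (\<pi> c) = fst (\<pi> d))"
proof -
  let ?G = "{..<m} \<times> {..<n}"
  note col' = col[rule_format]
  have inj: "\<pi> c = \<pi> d \<longleftrightarrow> c = d" for c d using permutes_inj[OF \<pi>] by (auto dest: injD)
  define R where "R c d \<longleftrightarrow> c \<noteq> d \<and> fst c = fst d" for c d :: "nat \<times> nat"
  define V where "V c d \<longleftrightarrow> c \<noteq> d \<and> snd c = snd d" for c d :: "nat \<times> nat"
  have edge: "(R c d \<or> V c d) \<longleftrightarrow> (R (\<pi> c) (\<pi> d) \<or> V (\<pi> c) (\<pi> d))" if "c \<in> ?G" "d \<in> ?G" for c d
    using col'[OF that] inj by (auto simp: R_def V_def collinear_cells_def)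
  have excl: "\<not> (R c d \<and> V c d)" for c d by (auto simp: R_def V_def prod_eq_iff)
  have opp: "\<not> collinear_cells d e" if "R c d" "V c e" for c d e
    using that by (auto simp: R_def V_def collinear_cells_def prod_eq_iff)
  have same: "collinear_cells d e" if "R c d \<and> R c e \<or> V c d \<and> V c e" for c d e
    using that by (auto simp: R_def V_def collinear_cells_def)
  have row_nb: "\<exists>d\<in>?G. R c d" if "c \<in> ?G" for c
    using that mn by (intro bexI[of _ "(fst c, if snd c = 0 then 1 else 0)"]) (auto simp: R_def prod_eq_iff)
  have col_nb: "\<exists>d\<in>?G. V c d" if "c \<in> ?G" for c
    using that mn by (intro bexI[of _ "(if fst c = 0 then 1 else 0, snd c)"]) (auto simp: V_def prod_eq_iff)
  define K where "K c \<longleftrightarrow> (\<forall>d\<in>?G. (R c d \<longrightarrow> R (\<pi> c) (\<pi> d)) \<and> (V c d \<longrightarrow> V (\<pi> c) (\<pi> d)))" for c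
  define S where "S c \<longleftrightarrow> (\<forall>d\<in>?G. (R c d \<longrightarrow> V (\<pi> c) (\<pi> d)) \<and> (V c d \<longrightarrow> R (\<pi> c) (\<pi> d)))" for c
  have KS: "K c \<or> S c" if c: "c \<in> ?G" for c
  proof -
    obtain d where d: "d \<in> ?G" "R c d" using row_nb[OF c] by blast
    have RV: "R (\<pi> c) (\<pi> d) \<longleftrightarrow> V (\<pi> c) (\<pi> e)" "V (\<pi> c) (\<pi> d) \<longleftrightarrow> R (\<pi> c) (\<pi> e)"
      if e: "e \<in> ?G" "V c e" for e
    proof -
      have "\<not> collinear_cells (\<pi> d) (\<pi> e)" using opp d e col' by metis
      then show "R (\<pi> c) (\<pi> d) \<longleftrightarrow> V (\<pi> c) (\<pi> e)" "V (\<pi> c) (\<pi> d) \<longleftrightarrow> R (\<pi> c) (\<pi> e)"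
        using same edge[OF c] d e excl by metis+
    qed
    \<comment> \<open>Two row neighbours of \<open>c\<close> are compared through a column neighbour
      \<open>f\<close>: it is collinear with neither, so both edges must have the type opposite to
      that of the edge to \<open>f\<close>, also after applying \<pi>.\<close>
    have RR: "R (\<pi> c) (\<pi> d) \<longleftrightarrow> R (\<pi> c) (\<pi> e)" "V (\<pi> c) (\<pi> d) \<longleftrightarrow> V (\<pi> c) (\<pi> e)"
      if e: "e \<in> ?G" "R c e" for e
    proof -
      obtain f where f: "f \<in> ?G" "V c f" using col_nb[OF c] by blast
      have "\<not> collinear_cells (\<pi> e) (\<pi> f)" using opp f e col' by metis
      then show "R (\<pi> c) (\<pi> d) \<longleftrightarrow> R (\<pi> c) (\<pi> e)" "V (\<pi> c) (\<pi> d) \<longleftrightarrow> V (\<pi> c) (\<pi> e)"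
        using same edge[OF c] d e f excl RV[OF f] by metis+
    qed
    from edge[OF c d(1)] d(2) have "R (\<pi> c) (\<pi> d) \<or> V (\<pi> c) (\<pi> d)" by blast
    then show ?thesis unfolding K_def S_def using RR RV by blast
  qed
  have not_both: "\<not> (K c \<and> S c)" if "c \<in> ?G" for c
    using row_nb[OF that] excl unfolding K_def S_def by blast
  have sym: "R c d \<longleftrightarrow> R d c" "V c d \<longleftrightarrow> V d c" for c d by (auto simp: R_def V_def)
  have step: "K c \<longleftrightarrow> K d" if "c \<in> ?G" "d \<in> ?G" "R c d \<or> V c d" for c d
    using that KS[of c] KS[of d] excl sym unfolding K_def S_def by metis
  have const: "K c \<longleftrightarrow> K d" if "c \<in> ?G" "d \<in> ?G" for c d
  proof -
    \<comment> \<open>The corner cell connects \<open>c\<close> to \<open>d\<close> by one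
      horizontal and one vertical edge, either of which may degenerate.\<close>
    let ?e = "(fst c, snd d)"
    have e: "?e \<in> ?G" using that by auto
    have "c = ?e \<or> R c ?e" "?e = d \<or> V ?e d" by (auto simp: R_def V_def prod_eq_iff)
    then show ?thesis using step[OF that(1) e] step[OF e that(2)] by metis
  qed
  show thesis
  proof (cases "K (0, 0)")
    case True
    have "(0, 0) \<in> ?G" using mn by auto
    then have K: "K c" if "c \<in> ?G" for c using const True that by blast
    have "(fst c = fst d \<longrightarrow> fst (\<pi> c) = fst (\<pi> d)) \<and> (snd c = snd d \<longrightarrow> snd (\<pi> c) = snd (\<pi> d))"
      if "c \<in> ?G" "d \<in> ?G" for c d
      using K[OF that(1)] that(2) unfolding K_def R_def V_def by (cases "c = d") blast+
    then show ?thesis by (intro keep ballI)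
  next
    case False
    have "(0, 0) \<in> ?G" using mn by auto
    then have S: "S c" if "c \<in> ?G" for c using const KS False that by blast
    have "(fst c = fst d \<longrightarrow> snd (\<pi> c) = snd (\<pi> d)) \<and> (snd c = snd d \<longrightarrow> fst (\<pi> c) = fst (\<pi> d))"
      if "c \<in> ?G" "d \<in> ?G" for c d
      using S[OF that(1)] that(2) unfolding S_def R_def V_def by (cases "c = d") blast+
    then show ?thesis by (intro swap ballI)
  qed
qed

section \<open>Trivial permutations as reindexings of rows and columns\<close>

lemma inj_on_extend_permutes:
  assumes "inj_on f {..<k::nat}" "f ` {..<k} \<subseteq> {..<k}"
  shows "(\<lambda>i. if i < k then f i else i) permutes {..<k}"
proof (rule bij_imp_permutes)
  have "f ` {..<k} = {..<k}" using assms by (intro card_subset_eq) (auto simp: card_image)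
  then show "bij_betw (\<lambda>i. if i < k then f i else i) {..<k} {..<k}"
    using assms by (auto simp: bij_betw_def inj_on_def image_def)
qed auto

text \<open>The left factor moves row k to row \<open>\<sigma> k\<close>, whereas the right factor
  fetches column \<open>\<tau> j\<close> into column j; hence the inverse on the row index
  only.\<close>

lemma mult_perm_mats:
  assumes X: "X \<in> carrier_mat m n" and \<sigma>: "\<sigma> permutes {..<m}" and \<tau>: "\<tau> permutes {..<n}"
  shows "mat m m (\<lambda>(i, j). if i = \<sigma> j then 1 else 0) * X * mat n n (\<lambda>(i, j). if i = \<tau> j then 1 else 0)
    = mat m n (\<lambda>(i, j). X $$ (inv_into UNIV \<sigma> i, \<tau> j) :: real)" (is "?P * X * ?Q = _")
proof (rule eq_matI)
  fix i j assume "i < dim_row (mat m n (\<lambda>(i, j). X $$ (inv_into UNIV \<sigma> i, \<tau> j) :: real))"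
    "j < dim_col (mat m n (\<lambda>(i, j). X $$ (inv_into UNIV \<sigma> i, \<tau> j) :: real))"
  then have ij: "i < m" "j < n" by auto
  have PX: "(?P * X) $$ (i, l) = X $$ (inv_into UNIV \<sigma> i, l)" if "l < n" for l
  proof -
    have "inv_into UNIV \<sigma> i < m" using permutes_in_image[OF permutes_inv[OF \<sigma>], of i] ij by simp
    have "(?P * X) $$ (i, l) = (\<Sum>k\<in>{0..<m}. (if i = \<sigma> k then 1 else 0) * X $$ (k, l))"
      using X ij that by (simp add: scalar_prod_def)
    also have "\<dots> = (\<Sum>k\<in>{0..<m}. if k = inv_into UNIV \<sigma> i then X $$ (k, l) else 0)"
      by (intro sum.cong) (auto simp: permutes_inverses[OF \<sigma>])
    also have "\<dots> = X $$ (inv_into UNIV \<sigma> i, l)" using \<open>inv_into UNIV \<sigma> i < m\<close> by simp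
    finally show ?thesis .
  qed
  have "\<tau> j < n" using permutes_in_image[OF \<tau>, of j] ij by simp
  have "(?P * X * ?Q) $$ (i, j) = (\<Sum>k\<in>{0..<n}. (?P * X) $$ (i, k) * (if k = \<tau> j then 1 else 0))"
    using X ij by (simp add: scalar_prod_def)
  also have "\<dots> = (\<Sum>k\<in>{0..<n}. if k = \<tau> j then X $$ (inv_into UNIV \<sigma> i, k) else 0)"
    by (intro sum.cong) (auto simp: PX)
  also have "\<dots> = X $$ (inv_into UNIV \<sigma> i, \<tau> j)" using \<open>\<tau> j < n\<close> by simp
  finally show "(?P * X * ?Q) $$ (i, j) = mat m n (\<lambda>(i, j). X $$ (inv_into UNIV \<sigma> i, \<tau> j)) $$ (i, j)"
    using ij by simp
qed (use X in auto)

lemma perm_mats_products: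
  assumes X: "X \<in> carrier_mat m n"
  shows "{P * X * Q | P Q. P \<in> perm_mats m \<and> Q \<in> perm_mats n} =
    {mat m n (\<lambda>(i, j). X $$ (\<sigma> i, \<tau> j)) | \<sigma> \<tau>. \<sigma> permutes {..<m} \<and> \<tau> permutes {..<n}}" (is "?A = ?B")
proof
  show "?A \<subseteq> ?B"
  proof
    fix Z assume "Z \<in> ?A"
    then obtain \<sigma> \<tau> where "\<sigma> permutes {..<m}" "\<tau> permutes {..<n}"
      "Z = mat m m (\<lambda>(i, j). if i = \<sigma> j then 1 else 0) * X * mat n n (\<lambda>(i, j). if i = \<tau> j then 1 else 0)"
      by (auto simp: perm_mats_def)
    then show "Z \<in> ?B" using mult_perm_mats[OF X] permutes_inv by blast
  qed
  show "?B \<subseteq> ?A"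
  proof
    fix Z assume "Z \<in> ?B"
    then obtain \<sigma> \<tau> where \<sigma>\<tau>: "\<sigma> permutes {..<m}" "\<tau> permutes {..<n}"
      "Z = mat m n (\<lambda>(i, j). X $$ (\<sigma> i, \<tau> j))" by blast
    have "mat m m (\<lambda>(i, j). if i = inv_into UNIV \<sigma> j then 1 else 0) \<in> perm_mats m"
      "mat n n (\<lambda>(i, j). if i = \<tau> j then 1 else 0) \<in> perm_mats n"
      unfolding perm_mats_def using \<sigma>\<tau> permutes_inv by blast+
    moreover have "Z = mat m m (\<lambda>(i, j). if i = inv_into UNIV \<sigma> j then 1 else 0) * X * mat n n (\<lambda>(i, j). if i = \<tau> j then 1 else 0)"
      using mult_perm_mats[OF X permutes_inv[OF \<sigma>\<tau>(1)] \<sigma>\<tau>(2)] \<sigma>\<tau> by (simp add: permutes_inv_inv)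
    ultimately show "Z \<in> ?A" by blast
  qed
qed

lemma trivial_perms_iff:
  assumes X: "X \<in> carrier_mat m n"
  shows "Z \<in> trivial_perms m n X \<longleftrightarrow>
    (\<exists>\<sigma> \<tau>. \<sigma> permutes {..<m} \<and> \<tau> permutes {..<n} \<and>
      (Z = mat m n (\<lambda>(i, j). X $$ (\<sigma> i, \<tau> j)) \<or> m = n \<and> Z = mat m n (\<lambda>(i, j). X\<^sup>T $$ (\<sigma> i, \<tau> j))))"
proof (cases "m = n")
  case True
  then have "X\<^sup>T \<in> carrier_mat m n" using X by simp
  from perm_mats_products[OF X] perm_mats_products[OF this] show ?thesis
    unfolding trivial_perms_def using True by auto
next
  case False
  then show ?thesis using perm_mats_products[OF X] unfolding trivial_perms_def by auto
qed

text \<open>If rows go to rows and columns to columns, the row of \<open>\<pi> (i, j)\<close>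
  depends on i alone and its column on j alone, so the values on row 0 and column 0 determine \<pi>.
  If the two are exchanged, the same holds after a transposition.\<close>

lemma collinear_permutation_trivial:
  assumes X: "X \<in> carrier_mat m n" and \<pi>: "\<pi> permutes ({..<m} \<times> {..<n})" and mn: "m \<ge> 2" "n \<ge> 2"
    and col: "\<forall>c\<in>{..<m} \<times> {..<n}. \<forall>d\<in>{..<m} \<times> {..<n}.
      collinear_cells (\<pi> c) (\<pi> d) \<longleftrightarrow> collinear_cells c d"
  shows "entry_perm \<pi> X \<in> trivial_perms m n X"
proof -
  have inj: "\<pi> c = \<pi> d \<longleftrightarrow> c = d" for c d using permutes_inj[OF \<pi>] by (auto dest: injD)
  have range: "fst (\<pi> (i, j)) < m" "snd (\<pi> (i, j)) < n" if "i < m" "j < n" for i j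
    using permutes_in_image[OF \<pi>, of "(i, j)"] that by (auto simp: mem_Times_iff)
  show ?thesis
  proof (rule collinear_permutation_cases[OF \<pi> mn col], goal_cases)
    case keep: 1
    define \<sigma> where "\<sigma> i = fst (\<pi> (i, 0))" for i
    define \<tau> where "\<tau> j = snd (\<pi> (0, j))" for j
    have \<pi>_eq: "\<pi> (i, j) = (\<sigma> i, \<tau> j)" if "i < m" "j < n" for i j
      using keep[rule_format, of "(i, j)" "(i, 0)"] keep[rule_format, of "(i, j)" "(0, j)"] that mn
      by (auto simp: \<sigma>_def \<tau>_def prod_eq_iff)
    have inj_\<sigma>: "inj_on \<sigma> {..<m}"
    proof (rule inj_onI)
      fix i i' assume "i \<in> {..<m}" "i' \<in> {..<m}" "\<sigma> i = \<sigma> i'"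
      then have "\<pi> (i, 0) = \<pi> (i', 0)" using \<pi>_eq[of i 0] \<pi>_eq[of i' 0] mn by simp
      then show "i = i'" using inj by simp
    qed
    have inj_\<tau>: "inj_on \<tau> {..<n}"
    proof (rule inj_onI)
      fix j j' assume "j \<in> {..<n}" "j' \<in> {..<n}" "\<tau> j = \<tau> j'"
      then have "\<pi> (0, j) = \<pi> (0, j')" using \<pi>_eq[of 0 j] \<pi>_eq[of 0 j'] mn by simp
      then show "j = j'" using inj by simp
    qed
    have im: "\<sigma> ` {..<m} \<subseteq> {..<m}" "\<tau> ` {..<n} \<subseteq> {..<n}"
      using range mn by (auto simp: \<sigma>_def \<tau>_def)
    have perm: "(\<lambda>i. if i < m then \<sigma> i else i) permutes {..<m}"
      "(\<lambda>j. if j < n then \<tau> j else j) permutes {..<n}" 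
      using inj_on_extend_permutes[OF inj_\<sigma> im(1)] inj_on_extend_permutes[OF inj_\<tau> im(2)] by auto
    have "entry_perm \<pi> X = mat m n (\<lambda>(i, j). X $$ (if i < m then \<sigma> i else i, if j < n then \<tau> j else j))"
      using X by (intro eq_matI) (auto simp: entry_perm_def \<pi>_eq)
    then show ?thesis unfolding trivial_perms_iff[OF X] using perm by blast
  next
    case swap: 2
    define \<sigma> where "\<sigma> i = snd (\<pi> (i, 0))" for i
    define \<tau> where "\<tau> j = fst (\<pi> (0, j))" for j
    have \<pi>_eq: "\<pi> (i, j) = (\<tau> j, \<sigma> i)" if "i < m" "j < n" for i j
      using swap[rule_format, of "(i, j)" "(i, 0)"] swap[rule_format, of "(i, j)" "(0, j)"] that mn
      by (auto simp: \<sigma>_def \<tau>_def prod_eq_iff)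
    have inj_\<sigma>: "inj_on \<sigma> {..<m}"
    proof (rule inj_onI)
      fix i i' assume "i \<in> {..<m}" "i' \<in> {..<m}" "\<sigma> i = \<sigma> i'"
      then have "\<pi> (i, 0) = \<pi> (i', 0)" using \<pi>_eq[of i 0] \<pi>_eq[of i' 0] mn by simp
      then show "i = i'" using inj by simp
    qed
    have inj_\<tau>: "inj_on \<tau> {..<n}"
    proof (rule inj_onI)
      fix j j' assume "j \<in> {..<n}" "j' \<in> {..<n}" "\<tau> j = \<tau> j'"
      then have "\<pi> (0, j) = \<pi> (0, j')" using \<pi>_eq[of 0 j] \<pi>_eq[of 0 j'] mn by simp
      then show "j = j'" using inj by simp
    qed
    have im: "\<sigma> ` {..<m} \<subseteq> {..<n}" "\<tau> ` {..<n} \<subseteq> {..<m}"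
      using range mn by (auto simp: \<sigma>_def \<tau>_def)
    \<comment> \<open>Exchanging rows and columns injects each of the two index sets into the other,
      so the matrix must be square.\<close>
    have "m \<le> n" "n \<le> m"
      using card_inj_on_le[OF inj_\<sigma> im(1)] card_inj_on_le[OF inj_\<tau> im(2)] by simp_all
    then have "m = n" by simp
    then have perm: "(\<lambda>i. if i < m then \<sigma> i else i) permutes {..<m}"
      "(\<lambda>j. if j < n then \<tau> j else j) permutes {..<n}"
      using inj_on_extend_permutes[OF inj_\<sigma>] inj_on_extend_permutes[OF inj_\<tau>] im \<open>m = n\<close> by auto
    have "entry_perm \<pi> X = mat m n (\<lambda>(i, j). X\<^sup>T $$ (if i < m then \<sigma> i else i, if j < n then \<tau> j else j))"
      using X im \<open>m = n\<close> by (intro eq_matI) (auto simp: entry_perm_def \<pi>_eq image_subset_iff)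
    then show ?thesis unfolding trivial_perms_iff[OF X] using perm \<open>m = n\<close> by blast
  qed
qed

section \<open>Detecting permutations that do not preserve collinearity\<close>

lemma rank_le_if_factorization_over:
  fixes Z :: "real mat"
  assumes Z: "Z \<in> carrier_mat m n" and L: "finite L" "card L \<le> k"
    and eq: "\<And>i j. i < m \<Longrightarrow> j < n \<Longrightarrow> Z $$ (i, j) = (\<Sum>l\<in>L. a i l * b l j)"
  shows "vec_space.rank m Z \<le> k"
proof -
  obtain f where f: "bij_betw f {..<card L} L"
    using ex_bij_betw_nat_finite[OF L(1)] by (auto simp: atLeast0LessThan)
  have "Z $$ (i, j) = (\<Sum>l<card L. a i (f l) * b (f l) j)" if "i < m" "j < n" for i j
    using eq[OF that] sum.reindex_bij_betw[OF f, of "\<lambda>l. a i l * b l j"] by simp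
  then have "vec_space.rank m Z \<le> card L" by (rule rank_le_if_factorization[OF Z])
  then show ?thesis using L by simp
qed

text \<open>Extends two non-collinear cells to a family of cells in distinct rows and columns. The
  number \<open>c\<close> is the preimage of \<open>b\<close> under the transposition of 0 and
  \<open>a\<close>; it is not 0 because \<open>a\<close> and \<open>b\<close> differ.\<close>

lemma injection_with_two_values:
  fixes a b :: nat
  assumes "a < m" "b < m" "a \<noteq> b"
  shows "\<exists>\<rho>. inj \<rho> \<and> (\<forall>s<m. \<rho> s < m) \<and> \<rho> 0 = a \<and> \<rho> 1 = b"
proof -
  define c where "c = Transposition.transpose 0 a b"
  have c: "c \<noteq> 0" "c < m" using assms by (auto simp: c_def Transposition.transpose_def)
  let ?\<rho> = "Transposition.transpose 0 a \<circ> Transposition.transpose 1 c"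
  have "inj ?\<rho>" by (intro inj_compose inj_transpose)
  moreover have "\<forall>s<m. ?\<rho> s < m" using assms c by (auto simp: Transposition.transpose_def)
  moreover have "?\<rho> 0 = a" using c by (simp add: Transposition.transpose_def)
  moreover have "?\<rho> 1 = b" by (simp add: c_def)
  ultimately show ?thesis by blast
qed

text \<open>The positions \<open>\<phi> s t\<close> are arbitrary cells because a minor of the
  permuted matrix collects scattered entries of X.\<close>

lemma minor_poly_funs:
  assumes "\<And>s t. s < k \<Longrightarrow> t < k \<Longrightarrow> \<phi> s t \<in> {..<m} \<times> {..<n}"
  shows "(\<lambda>X. det (mat k k (\<lambda>(s, t). X $$ \<phi> s t))) \<in> poly_funs (mat_coords m n)"
proof -
  have "(\<lambda>X. mat k k (\<lambda>(s, t). X $$ \<phi> s t) $$ (i, p i)) \<in> poly_funs (mat_coords m n)"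
    if p: "p permutes {0..<k}" and i: "i \<in> {0..<k}" for p i
  proof -
    have "p i < k" using permutes_in_image[OF p, of i] i by simp
    then obtain u v where "\<phi> i (p i) = (u, v)" "u < m" "v < n" using assms[of i "p i"] i by auto
    then show ?thesis using i \<open>p i < k\<close>
      by (intro poly_funs.coord) (auto simp: mat_coords_def)
  qed
  then have "(\<lambda>X. \<Sum>p\<in>{p. p permutes {0..<k}}. signof p *
      (\<Prod>i=0..<k. mat k k (\<lambda>(s, t). X $$ \<phi> s t) $$ (i, p i))) \<in> poly_funs (mat_coords m n)"
    by (intro poly_funs_sum poly_funs.mult poly_funs_prod poly_funs.const) auto
  then show ?thesis by (subst det_def'[where n = k]) auto
qed

text \<open>An \<open>(r + 1)\<close>-minor of the permuted matrix is the determinant of the identity on the 0/1 matrix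
  \<open>X0\<close> whose support is the image under \<open>\<pi>\<close> of \<open>r + 1\<close> cells in distinct rows and columns; that
  image has two collinear cells, hence lies in \<open>r\<close> rows or in \<open>r\<close> columns.\<close>

lemma non_collinear_pair_minor:
  assumes \<pi>: "\<pi> permutes ({..<m} \<times> {..<n})" and r: "1 \<le> r" "r < min m n"
    and cd: "c \<in> {..<m} \<times> {..<n}" "d \<in> {..<m} \<times> {..<n}" "\<not> collinear_cells c d"
      "collinear_cells (\<pi> c) (\<pi> d)"
  obtains f X0 where "f \<in> poly_funs (mat_coords m n)" "X0 \<in> rank_le_variety m n r" "f X0 \<noteq> 0"
    "\<And>X. X \<in> carrier_mat m n \<Longrightarrow> f X \<noteq> 0 \<Longrightarrow> vec_space.rank m (entry_perm \<pi> X) > r"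
proof -
  have "fst c < m" "fst d < m" "fst c \<noteq> fst d" "snd c < n" "snd d < n" "snd c \<noteq> snd d"
    using cd(1-3) by (auto simp: collinear_cells_def)
  note c_d = this
  obtain \<rho> where \<rho>: "inj \<rho>" "\<And>s. s < m \<Longrightarrow> \<rho> s < m" "\<rho> 0 = fst c" "\<rho> 1 = fst d"
    using injection_with_two_values[OF c_d(1-3)] by blast
  obtain \<kappa> where \<kappa>: "inj \<kappa>" "\<And>s. s < n \<Longrightarrow> \<kappa> s < n" "\<kappa> 0 = snd c" "\<kappa> 1 = snd d"
    using injection_with_two_values[OF c_d(4-6)] by blast
  have cell: "(\<rho> s, \<kappa> t) \<in> {..<m} \<times> {..<n}" if "s < Suc r" "t < Suc r" for s t
    using \<rho> \<kappa> that r by auto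
  define f where "f X = det (mat (Suc r) (Suc r) (\<lambda>(s, t). X $$ \<pi> (\<rho> s, \<kappa> t)))" for X :: "real mat"
  define S where "S = (\<lambda>s. \<pi> (\<rho> s, \<kappa> s)) ` {..<Suc r}"
  define X0 where "X0 = mat m n (\<lambda>c. if c \<in> S then 1 else 0 :: real)"
  have two: "\<pi> (\<rho> 0, \<kappa> 0) = \<pi> c" "\<pi> (\<rho> 1, \<kappa> 1) = \<pi> d" using \<rho> \<kappa> by simp_all
  \<comment> \<open>Used with \<open>fst\<close> and \<open>snd\<close>. The members 0 and 1 of the
    family are \<open>c\<close> and \<open>d\<close>, whose images share a value of
    \<open>g\<close>, so \<open>s = 0\<close> adds nothing to the r values from the other
    members.\<close>
  have card: "card (g ` S) \<le> r" if g: "g (\<pi> c) = g (\<pi> d)" for g :: "nat \<times> nat \<Rightarrow> nat"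
  proof -
    have "g ` S \<subseteq> (\<lambda>s. g (\<pi> (\<rho> s, \<kappa> s))) ` {1..<Suc r}"
    proof
      fix v assume "v \<in> g ` S"
      then obtain s where s: "s < Suc r" "v = g (\<pi> (\<rho> s, \<kappa> s))" by (auto simp: S_def)
      show "v \<in> (\<lambda>s. g (\<pi> (\<rho> s, \<kappa> s))) ` {1..<Suc r}"
      proof (cases "s = 0")
        case True
        then have "v = g (\<pi> (\<rho> 1, \<kappa> 1))" using s g two by metis
        then show ?thesis using r by (intro image_eqI[of _ _ 1]) auto
      qed (use s in auto)
    qed
    then have "card (g ` S) \<le> card ((\<lambda>s. g (\<pi> (\<rho> s, \<kappa> s))) ` {1..<Suc r})" by (intro card_mono) auto
    also have "\<dots> \<le> r" using card_image_le[of "{1..<Suc r}" "\<lambda>s. g (\<pi> (\<rho> s, \<kappa> s))"] by simp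
    finally show ?thesis .
  qed
  have finS: "finite S" by (simp add: S_def)
  have X0: "X0 \<in> carrier_mat m n" by (simp add: X0_def)
  have rank: "vec_space.rank m X0 \<le> r"
  proof (cases "fst (\<pi> c) = fst (\<pi> d)")
    case True
    have "X0 $$ (i, j) = (\<Sum>l\<in>fst ` S. (if l = i then 1 else 0) * (if (l, j) \<in> S then 1 else 0))"
      if "i < m" "j < n" for i j
    proof -
      have "(\<Sum>l\<in>fst ` S. (if l = i then 1 else 0) * (if (l, j) \<in> S then 1 else 0 :: real))
        = (\<Sum>l\<in>fst ` S. if l = i then (if (i, j) \<in> S then 1 else 0) else 0)"
        by (intro sum.cong) auto
      also have "\<dots> = (if i \<in> fst ` S then (if (i, j) \<in> S then 1 else 0) else 0)"
        using finS by (subst sum.delta) auto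
      also have "\<dots> = X0 $$ (i, j)" using that by (force simp: X0_def)
      finally show ?thesis by simp
    qed
    then show ?thesis
      using rank_le_if_factorization_over[OF X0, of "fst ` S" r "\<lambda>i l. if l = i then 1 else 0"
        "\<lambda>l j. if (l, j) \<in> S then 1 else 0"] card[of fst] True finS by blast
  next
    case False
    have "X0 $$ (i, j) = (\<Sum>l\<in>snd ` S. (if (i, l) \<in> S then 1 else 0) * (if l = j then 1 else 0))"
      if "i < m" "j < n" for i j
    proof -
      have "(\<Sum>l\<in>snd ` S. (if (i, l) \<in> S then 1 else 0) * (if l = j then 1 else 0 :: real))
        = (\<Sum>l\<in>snd ` S. if l = j then (if (i, j) \<in> S then 1 else 0) else 0)"
        by (intro sum.cong) auto
      also have "\<dots> = (if j \<in> snd ` S then (if (i, j) \<in> S then 1 else 0) else 0)"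
        using finS by (subst sum.delta) auto
      also have "\<dots> = X0 $$ (i, j)" using that by (force simp: X0_def)
      finally show ?thesis by simp
    qed
    moreover have "snd (\<pi> c) = snd (\<pi> d)" using False cd by (simp add: collinear_cells_def)
    ultimately show ?thesis
      using rank_le_if_factorization_over[OF X0, of "snd ` S" r "\<lambda>i l. if (i, l) \<in> S then 1 else 0"
        "\<lambda>l j. if l = j then 1 else 0"] card[of snd] finS by blast
  qed
  show thesis
  proof (rule that[of f X0])
    show "f \<in> poly_funs (mat_coords m n)" unfolding f_def[abs_def]
      by (rule minor_poly_funs) (use cell permutes_in_image[OF \<pi>] in blast)
    show "X0 \<in> rank_le_variety m n r" using X0 rank by (simp add: rank_le_variety_def)
    have "X0 $$ \<pi> (\<rho> s, \<kappa> t) = (if s = t then 1 else 0)" if st: "s < Suc r" "t < Suc r" for s t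
    proof -
      have "\<pi> (\<rho> s, \<kappa> t) \<in> {..<m} \<times> {..<n}" using cell[OF st] permutes_in_image[OF \<pi>] by blast
      then have "X0 $$ \<pi> (\<rho> s, \<kappa> t) = (if \<pi> (\<rho> s, \<kappa> t) \<in> S then 1 else 0)"
        by (cases "\<pi> (\<rho> s, \<kappa> t)") (auto simp: X0_def)
      moreover have "\<pi> (\<rho> s, \<kappa> t) \<in> S \<longleftrightarrow> s = t"
        using st \<rho>(1) \<kappa>(1) permutes_inj[OF \<pi>] by (auto simp: S_def inj_eq)
      ultimately show ?thesis by simp
    qed
    then have "mat (Suc r) (Suc r) (\<lambda>(s, t). X0 $$ \<pi> (\<rho> s, \<kappa> t)) = 1\<^sub>m (Suc r)"
      by (intro eq_matI) auto
    then show "f X0 \<noteq> 0" by (simp add: f_def)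
    fix X :: "real mat" assume X: "X \<in> carrier_mat m n" and fX: "f X \<noteq> 0"
    show "vec_space.rank m (entry_perm \<pi> X) > r"
    proof (rule ccontr)
      assume "\<not> ?thesis"
      moreover have "entry_perm \<pi> X \<in> carrier_mat m n" using X by (simp add: entry_perm_def)
      ultimately have "det (mat (Suc r) (Suc r) (\<lambda>(s, t). entry_perm \<pi> X $$ (\<rho> s, \<kappa> t))) = 0"
        using cell by (intro minor_zero_if_rank_le) auto
      moreover have "mat (Suc r) (Suc r) (\<lambda>(s, t). entry_perm \<pi> X $$ (\<rho> s, \<kappa> t)) =
          mat (Suc r) (Suc r) (\<lambda>(s, t). X $$ \<pi> (\<rho> s, \<kappa> t))"
        using cell X by (intro eq_matI) (auto simp: entry_perm_def)
      ultimately show False using fX by (simp add: f_def)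
    qed
  qed
qed

text \<open>For \<open>r = 0\<close> only the zero matrix occurs. Otherwise r + 1 is at least 2, and
  pairs of non-collinear cells can be tested. If \<pi> makes such a pair collinear, a minor shows
  that the permuted matrix generically has rank above r, and the claim is vacuous. If it never does,
  \<pi> acts injectively on the finite set of non-collinear pairs, hence surjectively, so it also
  preserves collinearity; the constant 1 then serves as f.\<close>

lemma generic_rank_preserving_permutation_trivial:
  assumes \<pi>: "\<pi> permutes ({..<m} \<times> {..<n})" and r: "r < min m n"
  shows "\<exists>f\<in>poly_funs (mat_coords m n). (\<exists>X\<in>rank_le_variety m n r. f X \<noteq> 0) \<and>
    (\<forall>X\<in>rank_le_variety m n r. f X \<noteq> 0 \<longrightarrow> vec_space.rank m (entry_perm \<pi> X) \<le> r \<longrightarrow>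
      entry_perm \<pi> X \<in> trivial_perms m n X)"
proof -
  let ?G = "{..<m} \<times> {..<n}"
  have zero: "0\<^sub>m m n \<in> rank_le_variety m n r"
    by (simp add: rank_le_variety_def vec_space.rank_0I)
  consider (0) "r = 0" | (bad) c d where "1 \<le> r" "c \<in> ?G" "d \<in> ?G" "\<not> collinear_cells c d"
      "collinear_cells (\<pi> c) (\<pi> d)"
    | (good) "1 \<le> r" "\<And>c d. c \<in> ?G \<Longrightarrow> d \<in> ?G \<Longrightarrow> \<not> collinear_cells c d \<Longrightarrow> \<not> collinear_cells (\<pi> c) (\<pi> d)"
    by fastforce
  then show ?thesis
  proof cases
    case 0
    have "entry_perm \<pi> X \<in> trivial_perms m n X" if X: "X \<in> rank_le_variety m n 0" for X
    proof -
      have Xc: "X \<in> carrier_mat m n" using X by (simp add: rank_le_variety_def)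
      then have X0: "X $$ c = 0" if "c \<in> ?G" for c
        using rank_le_iff_factorization[OF Xc, of 0] X that by (auto simp: rank_le_variety_def)
      have "entry_perm \<pi> X = mat m n (\<lambda>(i, j). X $$ (i, j))"
        using Xc X0 permutes_in_image[OF \<pi>] by (intro eq_matI) (auto simp: entry_perm_def)
      then show ?thesis unfolding trivial_perms_iff[OF Xc]
        by (intro exI[of _ id]) (auto simp: permutes_id)
    qed
    then show ?thesis using 0 zero by (intro bexI[of _ "\<lambda>_. 1"]) (auto intro: poly_funs.const)
  next
    case bad
    then obtain f X0 where "f \<in> poly_funs (mat_coords m n)" "X0 \<in> rank_le_variety m n r" "f X0 \<noteq> 0"
      "\<And>X. X \<in> carrier_mat m n \<Longrightarrow> f X \<noteq> 0 \<Longrightarrow> vec_space.rank m (entry_perm \<pi> X) > r"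
      using non_collinear_pair_minor[OF \<pi> _ r] by metis
    then show ?thesis by (intro bexI[of _ f]) (fastforce simp: rank_le_variety_def)+
  next
    case good
    define NC where "NC = {(c, d) \<in> ?G \<times> ?G. \<not> collinear_cells c d}"
    have "finite NC" unfolding NC_def by (rule finite_subset[of _ "?G \<times> ?G"]) auto
    moreover have "map_prod \<pi> \<pi> ` NC \<subseteq> NC"
    proof
      fix e assume "e \<in> map_prod \<pi> \<pi> ` NC"
      then obtain c d where "e = (\<pi> c, \<pi> d)" "(c, d) \<in> NC" by auto
      then show "e \<in> NC" using good(2)[of c d] permutes_in_image[OF \<pi>] by (simp add: NC_def)
    qed
    moreover have "inj_on (map_prod \<pi> \<pi>) NC"
      using inj_on_subset[OF prod.inj_map[OF permutes_inj[OF \<pi>] permutes_inj[OF \<pi>]]] by blast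
    ultimately have NC: "map_prod \<pi> \<pi> ` NC = NC" by (rule endo_inj_surj)
    have col: "collinear_cells (\<pi> c) (\<pi> d) \<longleftrightarrow> collinear_cells c d" if "c \<in> ?G" "d \<in> ?G" for c d
    proof
      assume "collinear_cells (\<pi> c) (\<pi> d)"
      then show "collinear_cells c d" using good(2) that by blast
    next
      assume c: "collinear_cells c d"
      show "collinear_cells (\<pi> c) (\<pi> d)"
      proof (rule ccontr)
        assume "\<not> ?thesis"
        then have "(\<pi> c, \<pi> d) \<in> NC" using that permutes_in_image[OF \<pi>] by (simp add: NC_def)
        then obtain e where e: "e \<in> NC" "map_prod \<pi> \<pi> e = (\<pi> c, \<pi> d)" using NC by (metis imageE)
        then have "fst e = c" "snd e = d" using permutes_inj[OF \<pi>] by (auto simp: map_prod_def split_def dest: injD)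
        then show False using c e(1) by (auto simp: NC_def)
      qed
    qed
    have "entry_perm \<pi> X \<in> trivial_perms m n X" if "X \<in> rank_le_variety m n r" for X
      using that good(1) r col by (intro collinear_permutation_trivial[OF _ \<pi>]) (auto simp: rank_le_variety_def)
    then show ?thesis using zero by (intro bexI[of _ "\<lambda>_. 1"]) (auto intro: poly_funs.const)
  qed
qed

section \<open>Generic linear combinations of equations\<close>

text \<open>Every chart contributes fewer than \<open>N\<close> parameters, and a vector orthogonal to a non-zero
  vector of length \<open>d\<close> has \<open>d - 1\<close> free entries, so the bad coefficient tuples are the image of a
  rational map from fewer than \<open>N * d\<close> parameters.\<close>

lemma generic_hyperplanes:
  fixes P :: "'c \<Rightarrow> nat \<Rightarrow> ('p \<Rightarrow> real) \<Rightarrow> real"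
  assumes "finite Q" "\<And>c. c \<in> Q \<Longrightarrow> finite (I c)" "\<And>c. c \<in> Q \<Longrightarrow> card (I c) < N"
    and P: "\<And>c i. c \<in> Q \<Longrightarrow> i < d \<Longrightarrow> P c i \<in> poly_funs (fun_coords (I c))"
  shows "\<exists>F\<in>poly_funs (fun_coords ({..<N} \<times> {..<d})). (\<exists>y. F y \<noteq> 0) \<and>
    (\<forall>c\<in>Q. \<forall>i<d. \<forall>x y. F y \<noteq> 0 \<longrightarrow> (\<forall>k<N. (\<Sum>i<d. y (k, i) * P c i x) = 0) \<longrightarrow> P c i x = 0)"
proof -
  let ?K = "{..<N} \<times> {..<d}"
  have "\<exists>F. F \<in> poly_funs (fun_coords ?K) \<and> (\<exists>y. F y \<noteq> 0) \<and>
      (\<forall>x y. P c i0 x \<noteq> 0 \<longrightarrow> (\<forall>k<N. (\<Sum>i<d. y (k, i) * P c i x) = 0) \<longrightarrow> F y = 0)"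
    if c: "c \<in> Q" and i0: "i0 < d" for c i0
  proof -
    \<comment> \<open>\<open>Inl\<close> stands for the entries of the \<open>N\<close> vectors
      except those at position \<open>i0\<close>, \<open>Inr\<close> for the parameters of the
      chart.\<close>
    define J :: "((nat \<times> nat) + 'p) set" where "J = ({..<N} \<times> ({..<d} - {i0})) <+> I c"
    have finJ: "finite J" using assms c by (simp add: J_def)
    have "card J = N * (d - 1) + card (I c)"
      using i0 assms c by (simp add: J_def card_Plus card_cartesian_product)
    also have "\<dots> < N * (d - 1) + N" using assms c by simp
    also have "\<dots> = card ?K" using i0 by (cases d) simp_all
    finally have card: "card J < card ?K" .
    define p where "p i z = P c i (\<lambda>a. z (Inr a))" for i and z :: "(nat \<times> nat) + 'p \<Rightarrow> real"
    \<comment> \<open>Orthogonality yields entry \<open>i0\<close> of each vector after division by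
      \<open>p i0\<close>. The free entries are multiplied by \<open>p i0\<close> too, because all
      coordinates share one denominator.\<close>
    define g where "g = (\<lambda>(k, i) z. if i = i0 then - 1 * (\<Sum>i\<in>{..<d} - {i0}. z (Inl (k, i)) * p i z)
      else z (Inl (k, i)) * p i0 z)"
    have p_poly: "p i \<in> poly_funs (fun_coords J)" if "i < d" for i
      unfolding p_def[abs_def]
    proof (rule poly_funs_comp[OF P[OF c that]])
      fix h :: "('p \<Rightarrow> real) \<Rightarrow> real" assume "h \<in> fun_coords (I c)"
      then show "(\<lambda>z. h (\<lambda>a. z (Inr a))) \<in> poly_funs (fun_coords J)"
        by (auto simp: fun_coords_def J_def intro!: poly_funs.coord)
    qed
    have g_poly: "g k \<in> poly_funs (fun_coords J)" if k: "k \<in> ?K" for k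
    proof -
      obtain k' i where ki: "k = (k', i)" "k' < N" "i < d" using k by auto
      have coord: "(\<lambda>z. z (Inl (k', i))) \<in> poly_funs (fun_coords J)" if "i < d" "i \<noteq> i0" for i
        using that ki by (intro fun_coords_poly_funs) (auto simp: J_def)
      show ?thesis
      proof (cases "i = i0")
        case True
        have "(\<lambda>z. - 1 * (\<Sum>i\<in>{..<d} - {i0}. z (Inl (k', i)) * p i z)) \<in> poly_funs (fun_coords J)"
          by (intro poly_funs.mult poly_funs.const poly_funs_sum coord p_poly) auto
        then show ?thesis using ki True by (simp add: g_def)
      next
        case False
        have "(\<lambda>z. z (Inl (k', i)) * p i0 z) \<in> poly_funs (fun_coords J)"
          using False ki i0 by (intro poly_funs.mult coord p_poly) auto
        then show ?thesis using ki False by (simp add: g_def)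
      qed
    qed
    obtain F y where F: "F \<in> poly_funs (fun_coords ?K)" "F y \<noteq> 0"
      "\<And>z y. p i0 z \<noteq> 0 \<Longrightarrow> (\<And>k. k \<in> ?K \<Longrightarrow> y k * p i0 z = g k z) \<Longrightarrow> F y = 0"
      using rational_image_annihilated[of J ?K g "p i0", OF finJ _ card g_poly p_poly[OF i0]]
      by (metis finite_SigmaI finite_lessThan)
    have "F y = 0" if x: "P c i0 x \<noteq> 0" and y: "\<And>k. k < N \<Longrightarrow> (\<Sum>i<d. y (k, i) * P c i x) = 0" for x y
    proof (rule F(3))
      let ?z = "case_sum y x"
      have p_z: "p i ?z = P c i x" for i by (simp add: p_def)
      show "p i0 ?z \<noteq> 0" using x p_z by simp
      fix k assume "k \<in> ?K"
      then obtain k' i where ki: "k = (k', i)" "k' < N" "i < d" by auto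
      have "0 = y (k', i0) * P c i0 x + (\<Sum>i\<in>{..<d} - {i0}. y (k', i) * P c i x)"
        using y[OF ki(2)] i0 by (simp add: sum.remove[of "{..<d}" i0])
      then show "y k * p i0 ?z = g k ?z" using ki by (auto simp: g_def p_z)
    qed
    then show ?thesis using F by blast
  qed
  then have "\<exists>F. \<forall>ci\<in>Q \<times> {..<d}. F ci \<in> poly_funs (fun_coords ?K) \<and> (\<exists>y. F ci y \<noteq> 0) \<and>
      (\<forall>x y. P (fst ci) (snd ci) x \<noteq> 0 \<longrightarrow> (\<forall>k<N. (\<Sum>i<d. y (k, i) * P (fst ci) i x) = 0) \<longrightarrow> F ci y = 0)"
    by (intro bchoice ballI) auto
  then obtain F where F: "\<forall>ci\<in>Q \<times> {..<d}. F ci \<in> poly_funs (fun_coords ?K) \<and> (\<exists>y. F ci y \<noteq> 0) \<and>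
      (\<forall>x y. P (fst ci) (snd ci) x \<noteq> 0 \<longrightarrow> (\<forall>k<N. (\<Sum>i<d. y (k, i) * P (fst ci) i x) = 0) \<longrightarrow> F ci y = 0)"
    by blast
  \<comment> \<open>One factor for each chart and each position at which the difference vector may
    be non-zero; the product is a non-zero polynomial since affine space is irreducible.\<close>
  define F' where "F' y = (\<Prod>ci\<in>Q \<times> {..<d}. F ci y)" for y
  have fin: "finite (Q \<times> {..<d})" using assms by simp
  have "\<exists>y\<in>UNIV. (\<Prod>ci\<in>Q \<times> {..<d}. F ci y) \<noteq> 0"
    using F by (intro curve_connected_prod_nonzero[OF curve_connected_UNIV[of ?K] _ fin]) auto
  then obtain y where "F' y \<noteq> 0" unfolding F'_def by blast
  moreover have "F' \<in> poly_funs (fun_coords ?K)" unfolding F'_def[abs_def]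
    using F by (intro poly_funs_prod) blast
  moreover have "P c i x = 0" if "c \<in> Q" "i < d" "F' y \<noteq> 0"
    "\<And>k. k < N \<Longrightarrow> (\<Sum>i<d. y (k, i) * P c i x) = 0" for c i x y
  proof (rule ccontr)
    assume "P c i x \<noteq> 0"
    then have "F (c, i) y = 0" using bspec[OF F, of "(c, i)"] that by simp
    then have "F' y = 0" unfolding F'_def using that(1,2) fin by (intro prod_zero) auto
    then show False using that(3) by simp
  qed
  ultimately show ?thesis by (intro bexI[of _ F']) blast+
qed

text \<open>The \<open>Inl\<close> coordinates are the entries of the columns in \<open>J\<close>, a basis of the column space; the
  \<open>Inr\<close> coordinates express the other columns in it.\<close>

definition column_chart ::
  "nat \<Rightarrow> nat \<Rightarrow> nat set \<Rightarrow> ((nat \<times> nat) + (nat \<times> nat) \<Rightarrow> real) \<Rightarrow> real mat" where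
  "column_chart m n J x = mat m n (\<lambda>(i, j). if j \<in> J then x (Inl (i, j))
     else \<Sum>j'\<in>J. x (Inl (i, j')) * x (Inr (j', j)))"

definition column_chart_params :: "nat \<Rightarrow> nat \<Rightarrow> nat set \<Rightarrow> ((nat \<times> nat) + (nat \<times> nat)) set" where
  "column_chart_params m n J = ({..<m} \<times> J) <+> (J \<times> ({..<n} - J))"

lemma column_chart_surj:
  assumes Z: "Z \<in> carrier_mat m n" "vec_space.rank m Z = r"
  obtains J x where "J \<subseteq> {..<n}" "card J = r" "column_chart m n J x = Z"
proof -
  obtain J u where J: "J \<subseteq> {..<n}" "card J = vec_space.rank m Z"
    "\<And>i j. i < m \<Longrightarrow> j < n \<Longrightarrow> Z $$ (i, j) = (\<Sum>j'\<in>J. Z $$ (i, j') * u j' j)"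
    using rank_column_basis[OF Z(1)] by metis
  have "column_chart m n J (case_sum (\<lambda>c. Z $$ c) (\<lambda>(j', j). u j' j)) = Z"
    using Z by (intro eq_matI) (auto simp: column_chart_def J(3)[symmetric])
  then show thesis using that J Z by blast
qed

lemma card_column_chart_params:
  assumes "J \<subseteq> {..<n}" "card J = r"
  shows "card (column_chart_params m n J) = r * (m + n - r)"
proof -
  have fin: "finite J" using assms finite_subset by blast
  have "r \<le> n" using assms card_mono[of "{..<n}" J] by simp
  have "card ({..<n} - J) = n - r" using assms fin by (simp add: card_Diff_subset)
  then have "card (column_chart_params m n J) = m * r + r * (n - r)"
    using assms fin by (simp add: column_chart_params_def card_Plus card_cartesian_product)
  also have "\<dots> = r * (m + (n - r))" by (simp add: algebra_simps)
  finally show ?thesis using \<open>r \<le> n\<close> by simp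
qed

lemma power_sum_column_chart_poly_funs:
  assumes "J \<subseteq> {..<n}"
  shows "(\<lambda>x. power_sum \<nu> (column_chart m n J x)) \<in> poly_funs (fun_coords (column_chart_params m n J))"
proof -
  have "(\<lambda>x. column_chart m n J x $$ (i, j)) \<in> poly_funs (fun_coords (column_chart_params m n J))"
    if ij: "i < m" "j < n" for i j
  proof (cases "j \<in> J")
    case True
    then have "(\<lambda>x. column_chart m n J x $$ (i, j)) = (\<lambda>x. x (Inl (i, j)))"
      using ij by (simp add: column_chart_def)
    then show ?thesis using True ij by (auto simp: column_chart_params_def intro!: fun_coords_poly_funs)
  next
    case False
    then have "(\<lambda>x. column_chart m n J x $$ (i, j)) = (\<lambda>x. \<Sum>j'\<in>J. x (Inl (i, j')) * x (Inr (j', j)))"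
      using ij by (simp add: column_chart_def)
    moreover have "(\<lambda>x. \<Sum>j'\<in>J. x (Inl (i, j')) * x (Inr (j', j))) \<in> poly_funs (fun_coords (column_chart_params m n J))"
      using False ij by (intro poly_funs_sum poly_funs.mult fun_coords_poly_funs)
        (auto simp: column_chart_params_def)
    ultimately show ?thesis by simp
  qed
  then have "(\<lambda>x. \<Sum>i<m. \<Sum>j<n. (column_chart m n J x $$ (i, j)) ^ \<nu>)
      \<in> poly_funs (fun_coords (column_chart_params m n J))"
    by (intro poly_funs_sum poly_funs_power) auto
  then show ?thesis by (simp add: power_sum_def column_chart_def)
qed

text \<open>The finitely many charts, one for each possible set of r basis columns, cover the rank-r
  matrices with r * (m + n - r) parameters each, which is below \<open>N\<close>.\<close>

lemma generic_lin_comb_eqs_imp_power_sums_eq: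
  assumes N: "r * (m + n - r) < N"
  shows "\<exists>F\<in>poly_funs (fun_coords ({..<N} \<times> {..<d})). (\<exists>y. F y \<noteq> 0) \<and>
    (\<forall>cs Z. length cs = N \<longrightarrow> F (\<lambda>(k, i). cs ! k $ i) \<noteq> 0 \<longrightarrow> Z \<in> carrier_mat m n \<longrightarrow>
      vec_space.rank m Z = r \<longrightarrow> (\<forall>c\<in>set cs. lin_comb_eq d c Y Z) \<longrightarrow>
      (\<forall>\<nu>\<in>{1..d}. power_sum \<nu> Z = power_sum \<nu> Y))"
proof -
  define Q where "Q = {J. J \<subseteq> {..<n} \<and> card J = r}"
  \<comment> \<open>Position i of a coefficient vector belongs to the exponent i + 1, hence
    \<open>Suc i\<close>.\<close>
  define P where "P J i x = power_sum (Suc i) (column_chart m n J x) - power_sum (Suc i) Y" for J i x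
  have "finite Q" unfolding Q_def by simp
  moreover have "finite (column_chart_params m n J)" if "J \<in> Q" for J
  proof -
    have "finite J" using that finite_subset[of J "{..<n}"] by (simp add: Q_def)
    then show ?thesis by (simp add: column_chart_params_def)
  qed
  moreover have "card (column_chart_params m n J) < N" if "J \<in> Q" for J
    using that N by (simp add: Q_def card_column_chart_params)
  moreover have "P J i \<in> poly_funs (fun_coords (column_chart_params m n J))" if "J \<in> Q" "i < d" for J i
    unfolding P_def[abs_def] using that
    by (intro poly_funs_diff poly_funs.const power_sum_column_chart_poly_funs) (simp add: Q_def)
  ultimately obtain F where F: "F \<in> poly_funs (fun_coords ({..<N} \<times> {..<d}))" "\<exists>y. F y \<noteq> 0"
    "\<forall>J\<in>Q. \<forall>i<d. \<forall>x y. F y \<noteq> 0 \<longrightarrow> (\<forall>k<N. (\<Sum>i<d. y (k, i) * P J i x) = 0) \<longrightarrow> P J i x = 0"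
    using generic_hyperplanes[of Q "column_chart_params m n" N d P] by blast
  show ?thesis
  proof (intro bexI[OF _ F(1)] conjI F(2) allI impI ballI)
    fix cs :: "real vec list" and Z :: "real mat" and \<nu> :: nat
    assume cs: "length cs = N" "F (\<lambda>(k, i). cs ! k $ i) \<noteq> 0" and Z: "Z \<in> carrier_mat m n" "vec_space.rank m Z = r"
      and eqs: "\<forall>c\<in>set cs. lin_comb_eq d c Y Z" and "\<nu> \<in> {1..d}"
    then have \<nu>: "1 \<le> \<nu>" "\<nu> \<le> d" by auto
    obtain J x where J: "J \<subseteq> {..<n}" "card J = r" "column_chart m n J x = Z"
      by (rule column_chart_surj[OF Z])
    have "(\<Sum>i<d. (case (k, i) of (k, i) \<Rightarrow> cs ! k $ i) * P J i x) = 0" if "k < N" for k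
    proof -
      have "lin_comb_eq d (cs ! k) Y Z" using eqs cs(1) that by simp
      then show ?thesis
        unfolding lin_comb_eq_def P_def J(3) by (simp add: sum.atLeast1_atMost_eq)
    qed
    then have "P J (\<nu> - 1) x = 0"
      using F(3)[rule_format, of J "\<nu> - 1" "\<lambda>(k, i). cs ! k $ i" x] cs(2) J \<nu> by (simp add: Q_def)
    then show "power_sum \<nu> Z = power_sum \<nu> Y" using \<nu> by (simp add: P_def J(3))
  qed
qed

section \<open>Power sums and rank of permuted matrices\<close>

lemma power_sum_altdef:
  "Z \<in> carrier_mat m n \<Longrightarrow> power_sum \<nu> Z = (\<Sum>c\<in>{..<m} \<times> {..<n}. (Z $$ c) ^ \<nu>)"
  by (simp add: power_sum_def sum.cartesian_product split_def)

lemma power_sum_entry_perm: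
  assumes X: "X \<in> carrier_mat m n" and \<pi>: "\<pi> permutes ({..<m} \<times> {..<n})"
  shows "power_sum \<nu> (entry_perm \<pi> X) = power_sum \<nu> X"
proof -
  have "entry_perm \<pi> X \<in> carrier_mat m n" using X by (simp add: entry_perm_def)
  then have "power_sum \<nu> (entry_perm \<pi> X) = (\<Sum>c\<in>{..<m} \<times> {..<n}. (entry_perm \<pi> X $$ c) ^ \<nu>)"
    by (rule power_sum_altdef)
  also have "\<dots> = (\<Sum>c\<in>{..<m} \<times> {..<n}. (X $$ \<pi> c) ^ \<nu>)"
    using X by (intro sum.cong) (auto simp: entry_perm_def)
  also have "\<dots> = power_sum \<nu> X"
    using sum.permute[OF \<pi>, of "\<lambda>c. (X $$ c) ^ \<nu>"] X by (simp add: power_sum_altdef o_def)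
  finally show ?thesis .
qed

lemma entry_perm_if_power_sums_eq:
  assumes X: "X \<in> carrier_mat m n" and Z: "Z \<in> carrier_mat m n"
    and "\<And>\<nu>. 1 \<le> \<nu> \<Longrightarrow> \<nu> \<le> m * n \<Longrightarrow> power_sum \<nu> Z = power_sum \<nu> X"
  obtains \<pi> where "\<pi> permutes ({..<m} \<times> {..<n})" "Z = entry_perm \<pi> X"
proof -
  let ?G = "{..<m} \<times> {..<n}"
  have "image_mset (\<lambda>c. Z $$ c) (mset_set ?G) = image_mset (\<lambda>c. X $$ c) (mset_set ?G)"
    by (rule image_mset_eq_if_power_sums_eq)
       (use assms power_sum_altdef[OF X] power_sum_altdef[OF Z] in auto)
  then obtain \<pi> where \<pi>: "\<pi> permutes ?G" "\<forall>c\<in>?G. Z $$ c = X $$ \<pi> c"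
    using image_mset_eq_implies_permutes[of ?G "\<lambda>c. Z $$ c" "\<lambda>c. X $$ c"] by auto
  have "Z = entry_perm \<pi> X" using X Z \<pi> by (intro eq_matI) (auto simp: entry_perm_def)
  then show thesis using that \<pi> by blast
qed

lemma power_sum_reindex:
  assumes X: "X \<in> carrier_mat m n" and \<sigma>: "\<sigma> permutes {..<m}" and \<tau>: "\<tau> permutes {..<n}"
  shows "power_sum \<nu> (mat m n (\<lambda>(i, j). X $$ (\<sigma> i, \<tau> j))) = power_sum \<nu> X"
proof -
  have "power_sum \<nu> (mat m n (\<lambda>(i, j). X $$ (\<sigma> i, \<tau> j))) = (\<Sum>i<m. \<Sum>j<n. (X $$ (\<sigma> i, \<tau> j)) ^ \<nu>)"
    by (simp add: power_sum_def)
  also have "\<dots> = (\<Sum>i<m. \<Sum>j<n. (X $$ (\<sigma> i, j)) ^ \<nu>)"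
    using sum.permute[OF \<tau>, of "\<lambda>j. (X $$ (\<sigma> _, j)) ^ \<nu>"] by (simp add: o_def)
  also have "\<dots> = (\<Sum>i<m. \<Sum>j<n. (X $$ (i, j)) ^ \<nu>)"
    using sum.permute[OF \<sigma>, of "\<lambda>i. \<Sum>j<n. (X $$ (i, j)) ^ \<nu>"] by (simp add: o_def)
  finally show ?thesis using X by (simp add: power_sum_def)
qed

lemma rank_reindex:
  fixes X :: "real mat"
  assumes X: "X \<in> carrier_mat m n" and \<sigma>: "\<sigma> permutes {..<m}" and \<tau>: "\<tau> permutes {..<n}"
  shows "vec_space.rank m (mat m n (\<lambda>(i, j). X $$ (\<sigma> i, \<tau> j))) = vec_space.rank m X"
proof (rule antisym)
  have \<sigma>': "\<sigma> i < m \<longleftrightarrow> i < m" "inv_into UNIV \<sigma> i < m \<longleftrightarrow> i < m" for i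
    using permutes_in_image[OF \<sigma>, of i] permutes_in_image[OF permutes_inv[OF \<sigma>], of i] by auto
  have \<tau>': "\<tau> j < n \<longleftrightarrow> j < n" "inv_into UNIV \<tau> j < n \<longleftrightarrow> j < n" for j
    using permutes_in_image[OF \<tau>, of j] permutes_in_image[OF permutes_inv[OF \<tau>], of j] by auto
  show "vec_space.rank m (mat m n (\<lambda>(i, j). X $$ (\<sigma> i, \<tau> j))) \<le> vec_space.rank m X"
    by (rule rank_le_reindex[OF X, where \<sigma> = \<sigma> and \<tau> = \<tau>]) (auto simp: \<sigma>' \<tau>')
  show "vec_space.rank m X \<le> vec_space.rank m (mat m n (\<lambda>(i, j). X $$ (\<sigma> i, \<tau> j)))"
    by (rule rank_le_reindex[OF _ X, where \<sigma> = "inv_into UNIV \<sigma>" and \<tau> = "inv_into UNIV \<tau>"])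
       (auto simp: \<sigma>' \<tau>' permutes_inverses[OF \<sigma>] permutes_inverses[OF \<tau>])
qed

lemma trivial_perms_rank_power_sum:
  assumes X: "X \<in> carrier_mat m n" and Z: "Z \<in> trivial_perms m n X"
  shows "Z \<in> carrier_mat m n" "vec_space.rank m Z = vec_space.rank m X" "power_sum \<nu> Z = power_sum \<nu> X"
proof -
  have XT: "vec_space.rank m (X\<^sup>T) = vec_space.rank m X" "power_sum \<nu> (X\<^sup>T) = power_sum \<nu> X" if "m = n"
  proof -
    show "vec_space.rank m (X\<^sup>T) = vec_space.rank m X"
      using rank_le_transpose[of X m] rank_le_transpose[of "X\<^sup>T" m] X that by auto
    show "power_sum \<nu> (X\<^sup>T) = power_sum \<nu> X"
      using X that sum.swap[of "\<lambda>i j. (X $$ (j, i)) ^ \<nu>" "{..<n}" "{..<n}"] by (simp add: power_sum_def)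
  qed
  \<comment> \<open>\<open>W\<close> is X or, for \<open>m = n\<close>, its transpose, so both kinds
    of trivial permutations reduce to reindexing.\<close>
  obtain W \<sigma> \<tau> where W: "W \<in> carrier_mat m n" "vec_space.rank m W = vec_space.rank m X"
      "power_sum \<nu> W = power_sum \<nu> X" and \<sigma>\<tau>: "\<sigma> permutes {..<m}" "\<tau> permutes {..<n}"
      and ZW: "Z = mat m n (\<lambda>(i, j). W $$ (\<sigma> i, \<tau> j))"
    using Z XT X unfolding trivial_perms_iff[OF X] by (metis transpose_carrier_mat)
  show "Z \<in> carrier_mat m n" using ZW by simp
  show "vec_space.rank m Z = vec_space.rank m X" using rank_reindex[OF W(1) \<sigma>\<tau>] ZW W(2) by simp
  show "power_sum \<nu> Z = power_sum \<nu> X" using power_sum_reindex[OF W(1) \<sigma>\<tau>] ZW W(3) by simp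
qed

theorem theorem2:
  fixes m n r :: nat
  assumes "m > 0" and "n > 0" and "r < min m n"
  shows "generic_in (mat_coords m n) (rank_le_variety m n r) (\<lambda>X. vec_space.rank m X = r \<longrightarrow>
    (\<forall>\<pi>. \<pi> permutes ({..<m} \<times> {..<n}) \<longrightarrow>
      generic_seq_in (vec_coords (m * n)) (carrier_vec (m * n)) (r * (m + n - r) + 1) (\<lambda>cs.
        {Z \<in> carrier_mat m n. vec_space.rank m Z = r \<and>
           (\<forall>c \<in> set cs. lin_comb_eq (m * n) c (entry_perm \<pi> X) Z)} = trivial_perms m n X)))"
proof -
  let ?G = "{..<m} \<times> {..<n}"
  let ?S = "{\<pi>. \<pi> permutes ?G}"
  let ?V = "rank_le_variety m n r"
  have "\<exists>f. \<forall>\<pi>\<in>?S. f \<pi> \<in> poly_funs (mat_coords m n) \<and> (\<exists>X\<in>?V. f \<pi> X \<noteq> 0) \<and>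
    (\<forall>X\<in>?V. f \<pi> X \<noteq> 0 \<longrightarrow> vec_space.rank m (entry_perm \<pi> X) \<le> r \<longrightarrow> entry_perm \<pi> X \<in> trivial_perms m n X)"
    using generic_rank_preserving_permutation_trivial[OF _ assms(3)] by (intro bchoice) blast
  then obtain f where f: "\<And>\<pi>. \<pi> \<in> ?S \<Longrightarrow> f \<pi> \<in> poly_funs (mat_coords m n)"
    "\<And>\<pi>. \<pi> \<in> ?S \<Longrightarrow> \<exists>X\<in>?V. f \<pi> X \<noteq> 0"
    "\<And>\<pi> X. \<pi> \<in> ?S \<Longrightarrow> X \<in> ?V \<Longrightarrow> f \<pi> X \<noteq> 0 \<Longrightarrow> vec_space.rank m (entry_perm \<pi> X) \<le> r \<Longrightarrow>
      entry_perm \<pi> X \<in> trivial_perms m n X" by blast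
  have fin: "finite ?S" by (intro finite_permutations) simp
  \<comment> \<open>The open set has to be chosen before \<pi>, so it must suit all of the finitely
    many permutations at once.\<close>
  define g where "g X = (\<Prod>\<pi>\<in>?S. f \<pi> X)" for X
  define U where "U = {X \<in> ?V. g X \<noteq> 0}"
  have "g \<in> poly_funs (mat_coords m n)" unfolding g_def[abs_def] by (intro poly_funs_prod f)
  then have "zariski_open_in (mat_coords m n) ?V U"
    unfolding zariski_open_in_def U_def by (intro exI[of _ "{g}"]) auto
  moreover have "?V \<noteq> {}" using f(2)[of id] by (auto simp: permutes_id)
  then have "U \<noteq> {}" unfolding U_def g_def
    using curve_connected_prod_nonzero[OF curve_connected_rank_le_variety _ fin] f by blast
  moreover have "generic_seq_in (vec_coords (m * n)) (carrier_vec (m * n)) (r * (m + n - r) + 1) (\<lambda>cs.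
        {Z \<in> carrier_mat m n. vec_space.rank m Z = r \<and>
           (\<forall>c \<in> set cs. lin_comb_eq (m * n) c (entry_perm \<pi> X) Z)} = trivial_perms m n X)"
    if XU: "X \<in> U" and rank: "vec_space.rank m X = r" and \<pi>: "\<pi> permutes ?G" for X \<pi>
  proof -
    have X: "X \<in> carrier_mat m n" "X \<in> ?V" using XU by (auto simp: U_def rank_le_variety_def)
    have fX: "f \<pi>' X \<noteq> 0" if "\<pi>' \<in> ?S" for \<pi>'
      using XU fin that by (auto simp: U_def g_def)
    let ?Y = "entry_perm \<pi> X" and ?N = "r * (m + n - r) + 1"
    obtain F y where F: "F \<in> poly_funs (fun_coords ({..<?N} \<times> {..<m * n}))" "F y \<noteq> 0"
      "\<forall>cs Z. length cs = ?N \<longrightarrow> F (\<lambda>(k, i). cs ! k $ i) \<noteq> 0 \<longrightarrow> Z \<in> carrier_mat m n \<longrightarrow>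
        vec_space.rank m Z = r \<longrightarrow> (\<forall>c\<in>set cs. lin_comb_eq (m * n) c ?Y Z) \<longrightarrow>
        (\<forall>\<nu>\<in>{1..m * n}. power_sum \<nu> Z = power_sum \<nu> ?Y)"
      using generic_lin_comb_eqs_imp_power_sums_eq[of r m n ?N "m * n" ?Y] less_add_one by blast
    show ?thesis
    proof (rule generic_seq_inI[OF F(1,2)], rule subset_antisym)
      fix cs :: "real vec list"
      assume cs: "length cs = ?N" "F (\<lambda>(k, i). cs ! k $ i) \<noteq> 0"
      show "{Z \<in> carrier_mat m n. vec_space.rank m Z = r \<and> (\<forall>c \<in> set cs. lin_comb_eq (m * n) c ?Y Z)}
        \<subseteq> trivial_perms m n X"
      proof safe
        fix Z assume Z: "Z \<in> carrier_mat m n" "r = vec_space.rank m Z"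
          and eqs: "\<forall>c \<in> set cs. lin_comb_eq (m * n) c ?Y Z"
        have ps: "power_sum \<nu> Z = power_sum \<nu> X" if "1 \<le> \<nu>" "\<nu> \<le> m * n" for \<nu>
          using F(3) cs Z eqs that by (simp add: power_sum_entry_perm[OF X(1) \<pi>])
        \<comment> \<open>Power sums forget the arrangement of the entries, so \<pi>' may differ
          from \<pi>; the choice of \<open>U\<close> applies to it because Z has rank r.\<close>
        obtain \<pi>' where "\<pi>' permutes ?G" "Z = entry_perm \<pi>' X"
          by (rule entry_perm_if_power_sums_eq[OF X(1) Z(1) ps])
        then show "Z \<in> trivial_perms m n X" using f(3)[of \<pi>' X] fX X Z by simp
      qed
      \<comment> \<open>This inclusion holds for all coefficients: every bracket in the linear
        combinations is zero.\<close>
      show "trivial_perms m n X \<subseteq> {Z \<in> carrier_mat m n. vec_space.rank m Z = r \<and>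
          (\<forall>c \<in> set cs. lin_comb_eq (m * n) c ?Y Z)}"
        using trivial_perms_rank_power_sum[OF X(1)] rank
        by (auto simp: lin_comb_eq_def power_sum_entry_perm[OF X(1) \<pi>])
    qed
  qed
  ultimately show ?thesis unfolding generic_in_def by blast
qed

end
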